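(* Let $G$ be any graph and let $C_1,C_2\subseteq G$ be two different circles. Then there exist a Cantor set $B$, a minimal continuous map $f:B\to B$, a connected graph $\Gamma$, a continuous map $F:B\times\Gamma\to B\times\Gamma$ with $\mathrm{pr}_1\circ F=f\circ\mathrm{pr}_1$, a minimal set $M$ of $F$ and a point $b\in B$ such that $M_z=M\cap(\{z\}\times\Gamma)$ is a circle for each $z\ne b$, and $M_b$ is a union of two circles homeomorphic to $C_1\cup C_2$. In particular, there exist such systems for which $M_b$ is a union of two disjoint circles.
   Context: A graph is a nonempty compact metric space that is a union of finitely many arcs, any two of which are disjoint or meet only in one or both of their end-points. A circle is a simple closed curve. A continuous selfmap of a compact metric space is minimal if it has no proper nonempty closed invariant subset; a minimal set of $F$ is a nonempty closed set $M$ with $F(M)\subseteq M$ on which $F$ is minimal. *)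

theory Defs
  imports "HOL-Analysis.Analysis"
begin

definition is_graph :: "'a::metric_space set \<Rightarrow> bool" where
  "is_graph G \<longleftrightarrow>
     (\<exists>\<G> :: (real \<Rightarrow> 'a) set. finite \<G> \<and> \<G> \<noteq> {} \<and> (\<forall>g\<in>\<G>. arc g) \<and>
        G = \<Union>(path_image ` \<G>) \<and>
        (\<forall>g\<in>\<G>. \<forall>g'\<in>\<G>. path_image g \<noteq> path_image g' \<longrightarrow>
            path_image g \<inter> path_image g' \<subseteq>
              {pathstart g, pathfinish g} \<inter> {pathstart g', pathfinish g'}))"

definition circle :: "'a::topological_space set \<Rightarrow> bool" where
  "circle C \<longleftrightarrow> C homeomorphic (sphere (0::complex) 1)"

definition cantor_ternary :: "real set" where
  "cantor_ternary = {x. \<exists>a::nat \<Rightarrow> bool. x = (\<Sum>n. (if a n then 2 else 0) / 3 ^ Suc n)}"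

definition cantor_set :: "'a::topological_space set \<Rightarrow> bool" where
  "cantor_set B \<longleftrightarrow> B homeomorphic cantor_ternary"

definition minimal_map :: "'a::metric_space set \<Rightarrow> ('a \<Rightarrow> 'a) \<Rightarrow> bool" where
  "minimal_map X f \<longleftrightarrow> continuous_on X f \<and> f ` X \<subseteq> X \<and>
     (\<forall>K. K \<subseteq> X \<and> closedin (top_of_set X) K \<and> K \<noteq> {} \<and> f ` K \<subseteq> K \<longrightarrow> K = X)"

definition minimal_set :: "('a::metric_space \<Rightarrow> 'a) \<Rightarrow> 'a set \<Rightarrow> bool" where
  "minimal_set F M \<longleftrightarrow> M \<noteq> {} \<and> closed M \<and> F ` M \<subseteq> M \<and>
     (\<forall>K. K \<subseteq> M \<and> closedin (top_of_set M) K \<and> K \<noteq> {} \<and> F ` K \<subseteq> K \<longrightarrow> K = M)"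

text \<open>The skew-product system required by the theorem, with the fibre over b
  satisfying a given property P.  The Cantor set lives in the reals and the graph
  \<Gamma> in real^3 (every Cantor set embeds in R, every graph in R^3).\<close>
definition skew_system ::
  "real set \<Rightarrow> (real \<Rightarrow> real) \<Rightarrow> (real^3) set \<Rightarrow> (real \<times> (real^3) \<Rightarrow> real \<times> (real^3))
    \<Rightarrow> (real \<times> (real^3)) set \<Rightarrow> real \<Rightarrow> bool" where
  "skew_system B f \<Gamma> F M b \<longleftrightarrow>
     cantor_set B \<and> minimal_map B f \<and> is_graph \<Gamma> \<and> connected \<Gamma> \<and>
     continuous_on (B \<times> \<Gamma>) F \<and> F ` (B \<times> \<Gamma>) \<subseteq> B \<times> \<Gamma> \<and>
     (\<forall>p\<in>B \<times> \<Gamma>. fst (F p) = f (fst p)) \<and>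
     M \<subseteq> B \<times> \<Gamma> \<and> minimal_set F M \<and> b \<in> B \<and>
     (\<forall>z\<in>B. z \<noteq> b \<longrightarrow> circle (M \<inter> ({z} \<times> \<Gamma>)))"

end

theory Submission
  imports Defs
begin

text \<open>Suppose that a connected graph \<open>\<Gamma>\<close> carries a continuous map \<open>h\<close> onto the unit circle with
  continuous sections \<open>s\<^sub>0, \<dots>, s\<^sub>N\<^sub>-\<^sub>1\<close>, and that \<open>f\<close> is a minimal map of a Cantor set \<open>B\<close>, injective except that
  one point \<open>b\<close> has \<open>N\<close> preimages, which are told apart by a locally constant index. For an irrational
  rotation \<open>\<rho>\<close> put \<open>F (z, x) = (f z, s\<^sub>i (\<rho> h(x)))\<close> with \<open>i\<close> the index of \<open>z\<close>, and let \<open>M\<close> be the image of \<open>F\<close>.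
  The fibre of \<open>M\<close> over \<open>b\<close> is the union of the images of all sections, and every other fibre is the
  image of one section, hence a circle. A closed invariant subset \<open>K\<close> of \<open>M\<close> projects onto \<open>B \<times> S\<^sup>1\<close> because
  \<open>f \<times> \<rho>\<close> is minimal, and \<open>F(K)\<close> depends only on this projection, so \<open>K = M\<close>.

  It remains to write the union of two circles in a graph as a union of sections. If they meet, the second
  circle consists of a part of the first one and of finitely many arcs with end-points on the first one.
  Map the first circle homeomorphically onto \<open>S\<^sup>1\<close> and each such arc homeomorphically onto one of the arcs
  of \<open>S\<^sup>1\<close> between the images of its end-points; replacing the latter arc by the former gives a section.
  Disjoint circles are two parallel sections, joined by a segment.\<close>

section \<open>The Cantor set\<close>

definition ternary_value :: "(nat \<Rightarrow> bool) \<Rightarrow> real" where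
  "ternary_value a = (\<Sum>n. (if a n then 2 else 0) / 3 ^ Suc n)"

lemma cantor_ternary_eq_range: "cantor_ternary = range ternary_value"
  by (auto simp: cantor_ternary_def ternary_value_def)

lemma sums_two_thirds: "(\<lambda>n. 2 / 3 ^ Suc n :: real) sums 1"
proof -
  have "(\<lambda>n. (2/3) * (1/3) ^ n :: real) sums ((2/3) * (1 / (1 - 1/3)))"
    by (intro sums_mult geometric_sums) auto
  then show ?thesis by (simp add: power_one_over field_simps)
qed

lemma summable_ternary: "summable (\<lambda>n. (if a n then 2 else 0) / 3 ^ Suc n :: real)"
  by (rule summable_comparison_test'[OF sums_summable[OF sums_two_thirds], of 0]) auto

lemma ternary_value_bounds: "0 \<le> ternary_value a" "ternary_value a \<le> 1"
proof -
  show "0 \<le> ternary_value a"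
    unfolding ternary_value_def by (intro suminf_nonneg summable_ternary) auto
  have "ternary_value a \<le> (\<Sum>n. 2 / 3 ^ Suc n)"
    unfolding ternary_value_def
    by (intro suminf_le summable_ternary sums_summable[OF sums_two_thirds]) (auto simp: divide_right_mono)
  then show "ternary_value a \<le> 1" using sums_unique[OF sums_two_thirds] by simp
qed

lemma ternary_value_rec:
  "ternary_value a = (if a 0 then 2 else 0) / 3 + ternary_value (\<lambda>n. a (Suc n)) / 3"
proof -
  have "ternary_value a = (if a 0 then 2 else 0) / 3
      + (\<Sum>n. (if a (Suc n) then 2 else 0) / 3 ^ Suc (Suc n))"
    unfolding ternary_value_def using suminf_split_head[OF summable_ternary[of a]] by simp
  also have "(\<Sum>n. (if a (Suc n) then 2 else 0) / 3 ^ Suc (Suc n) :: real)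
      = ternary_value (\<lambda>n. a (Suc n)) / 3"
    unfolding ternary_value_def
    by (subst suminf_divide[OF summable_ternary, symmetric]) (simp add: field_simps)
  finally show ?thesis .
qed

text \<open>The shifted values lie in [0, 1], so a first digit 0 keeps the value at most 1/3 and a
  first digit 2 lifts it to at least 2/3. Equal values therefore share the first digit, and
  cancelling it leaves the tails.\<close>

lemma ternary_value_eq_head:
  assumes "ternary_value a = ternary_value b"
  shows "a 0 = b 0" "ternary_value (\<lambda>n. a (Suc n)) = ternary_value (\<lambda>n. b (Suc n))"
proof -
  note bd = ternary_value_bounds[of "\<lambda>n. a (Suc n)"] ternary_value_bounds[of "\<lambda>n. b (Suc n)"]
  show "a 0 = b 0"
    using assms bd ternary_value_rec[of a] ternary_value_rec[of b] by (cases "a 0"; cases "b 0") auto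
  then show "ternary_value (\<lambda>n. a (Suc n)) = ternary_value (\<lambda>n. b (Suc n))"
    using assms ternary_value_rec[of a] ternary_value_rec[of b] by auto
qed

lemma inj_ternary_value: "inj ternary_value"
proof
  have "a n = b n" if "ternary_value a = ternary_value b" for a b n
    using that
  proof (induction n arbitrary: a b)
    case (Suc n)
    then show ?case using ternary_value_eq_head(2) by blast
  qed (use ternary_value_eq_head(1) in blast)
  then show "a = b" if "ternary_value a = ternary_value b" for a b using that by blast
qed

text \<open>The terms are continuous and bounded by 2 / 3^(n+1), so the partial sums converge
  uniformly by the M-test.\<close>

lemma continuous_on_ternary_value:
  fixes bit :: "'a::topological_space \<Rightarrow> nat \<Rightarrow> bool"
  assumes "\<And>n. continuous_on X (\<lambda>x. if bit x n then 2 else 0 :: real)"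
  shows "continuous_on X (\<lambda>x. ternary_value (bit x))"
proof -
  have "uniform_limit X (\<lambda>n x. \<Sum>i<n. (if bit x i then 2 else 0) / 3 ^ Suc i)
      (\<lambda>x. ternary_value (bit x)) sequentially"
    unfolding ternary_value_def
    by (rule Weierstrass_m_test[OF _ sums_summable[OF sums_two_thirds]]) auto
  then show ?thesis
    by (rule uniform_limit_theorem[rotated])
       (auto intro!: always_eventually continuous_intros assms simp del: power_Suc)
qed

text \<open>The points are addressed by a binary tree of nonempty clopen cells: at level \<open>n\<close> a cell is cut by
  \<open>U n\<close> if possible, and otherwise by the first set of the family that cuts it.\<close>

lemma clopen_separated_imp_cantor_set:
  fixes X :: "'a::topological_space set" and U :: "nat \<Rightarrow> 'a set"
  assumes X: "compact X" "X \<noteq> {}"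
    and op: "\<And>n. openin (top_of_set X) (X \<inter> U n)"
    and cl: "\<And>n. closedin (top_of_set X) (X \<inter> U n)"
    and sep: "\<And>x y. x \<in> X \<Longrightarrow> y \<in> X \<Longrightarrow> x \<noteq> y \<Longrightarrow> \<exists>n. (x \<in> U n) \<noteq> (y \<in> U n)"
    and perf: "\<And>x V. x \<in> V \<Longrightarrow> openin (top_of_set X) V \<Longrightarrow> \<exists>y\<in>V. y \<noteq> x"
  shows "cantor_set X"
proof -
  define splits where "splits S k \<longleftrightarrow> S \<inter> U k \<noteq> {} \<and> S - U k \<noteq> {}" for S k
  define cut where "cut n S = (if splits S n then n else (LEAST k. splits S k))" for n S
  define A :: "(nat \<Rightarrow> bool) \<Rightarrow> nat \<Rightarrow> 'a set" where
    "A a = rec_nat X (\<lambda>n S. if a n then S \<inter> U (cut n S) else S - U (cut n S))" for a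
  have A0: "A a 0 = X" and AS: "A a (Suc n) = (if a n then A a n \<inter> U (cut n (A a n)) else A a n - U (cut n (A a n)))" for a n
    by (simp_all add: A_def)
  \<comment> \<open>\<open>A\<close> follows a prescribed address, \<open>cell x\<close> the address
    that the point \<open>x\<close> itself generates; \<open>cell_A\<close> identifies the
    two.\<close>
  define cell where "cell x = rec_nat X (\<lambda>n S. if x \<in> U (cut n S) then S \<inter> U (cut n S) else S - U (cut n S))" for x
  have c0: "cell x 0 = X" and cS: "cell x (Suc n) = (if x \<in> U (cut n (cell x n)) then cell x n \<inter> U (cut n (cell x n)) else cell x n - U (cut n (cell x n)))" for x n
    by (simp_all add: cell_def)
  define bit where "bit x n \<longleftrightarrow> x \<in> U (cut n (cell x n))" for x n
  have cell_A: "cell x n = A (bit x) n" for x n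
    by (induction n) (auto simp: A0 AS c0 cS bit_def)
  \<comment> \<open>Without isolated points a nonempty open cell has two points, and some
    \<open>U k\<close> separates them; so the search in \<open>cut\<close> always succeeds.\<close>
  have splits_cut: "splits S (cut n S)" if S: "openin (top_of_set X) S" "S \<noteq> {}" for S n
  proof -
    obtain x where x: "x \<in> S" using S(2) by blast
    obtain y where y: "y \<in> S" "y \<noteq> x" using perf[OF x S(1)] by auto
    have "S \<subseteq> X" using S openin_imp_subset by blast
    then obtain k where "(x \<in> U k) \<noteq> (y \<in> U k)" using sep x y by (metis subsetD)
    then have "splits S k" unfolding splits_def using x y by blast
    then show ?thesis unfolding cut_def by (auto intro: LeastI)
  qed
  have A_clopen: "openin (top_of_set X) (A a n) \<and> closedin (top_of_set X) (A a n) \<and> A a n \<noteq> {}" for a n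
  proof (induction n)
    case 0
    then show ?case using X by (simp add: A0)
  next
    case (Suc n)
    let ?U = "U (cut n (A a n))"
    have sub: "A a n \<subseteq> X" using Suc openin_imp_subset by blast
    have eq: "A a n \<inter> ?U = A a n \<inter> (X \<inter> ?U)" "A a n - ?U = A a n - (X \<inter> ?U)" using sub by auto
    have "splits (A a n) (cut n (A a n))" using splits_cut Suc by blast
    then have "A a n \<inter> ?U \<noteq> {}" "A a n - ?U \<noteq> {}" by (auto simp: splits_def)
    moreover have "openin (top_of_set X) (A a n \<inter> ?U)" "closedin (top_of_set X) (A a n \<inter> ?U)"
      "openin (top_of_set X) (A a n - ?U)" "closedin (top_of_set X) (A a n - ?U)"
      unfolding eq using Suc op cl by (blast intro: openin_Int closedin_Int openin_diff closedin_diff)+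
    ultimately show ?case by (auto simp: AS)
  qed
  have in_cell: "x \<in> cell x n" if "x \<in> X" for x n
    using that by (induction n) (auto simp: c0 cS)
  have A_dec: "A a n \<subseteq> A a m" if "m \<le> n" for a m n
    using that by (induction rule: dec_induct) (auto simp: AS)
  \<comment> \<open>Bit \<open>n\<close> is decided on passing from level \<open>n\<close> to the
    next one, hence the bound \<open>Suc n\<close>.\<close>
  have bit_A: "bit y n = a n \<and> cell y n = A a n" if "\<And>m. m \<le> Suc n \<Longrightarrow> y \<in> A a m" for y a n
    using that
  proof (induction n)
    case 0
    then show ?case using "0"[of 1] by (auto simp: bit_def c0 A0 AS split: if_splits)
  next
    case (Suc n)
    then have IH: "bit y n = a n" "cell y n = A a n" by auto
    then have "cell y (Suc n) = A a (Suc n)" by (simp add: cS AS bit_def)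
    then show ?case using Suc.prems[of "Suc (Suc n)"] by (auto simp: bit_def AS split: if_splits)
  qed
  \<comment> \<open>Along an address the cells are nonempty, closed and decreasing, so compactness
    yields a common point.\<close>
  have surj: "\<exists>x\<in>X. bit x = a" for a
  proof -
    have "(\<Inter>n. A a n) \<noteq> {}"
    proof -
      have "\<exists>z. z \<in> X \<and> (\<forall>n. z \<in> A a n)"
      proof (rule ccontr)
        assume no: "\<not> ?thesis"
        have "compactin (top_of_set X) X" using X(1) by (simp add: compactin_subtopology)
        moreover have "\<forall>V\<in>range (\<lambda>n. X - A a n). openin (top_of_set X) V"
          using A_clopen by (auto intro: openin_diff)
        moreover have "X \<subseteq> \<Union>(range (\<lambda>n. X - A a n))" using no by auto
        ultimately obtain \<F> where F: "finite \<F>" "\<F> \<subseteq> range (\<lambda>n. X - A a n)" "X \<subseteq> \<Union>\<F>"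
          unfolding compactin_def by meson
        then obtain I where I: "finite I" "\<F> = (\<lambda>n. X - A a n) ` I" by (meson finite_subset_image)
        obtain k where k: "\<forall>n\<in>I. n \<le> k" using I(1) finite_nat_set_iff_bounded_le by blast
        obtain x where "x \<in> A a k" using A_clopen by blast
        moreover have "x \<in> X" using calculation A_dec[of 0 k a] by (auto simp: A0)
        ultimately show False using F(3) I k A_dec by blast
      qed
      then show ?thesis by auto
    qed
    then obtain x where x: "\<And>n. x \<in> A a n" by auto
    then have "bit x = a" using bit_A by blast
    moreover have "x \<in> X" using x[of 0] by (simp add: A0)
    ultimately show ?thesis by blast
  qed
  \<comment> \<open>Points with equal bits share their cell at level \<open>n\<close>. If
    \<open>U n\<close> separates them, it splits this cell and is chosen by \<open>cut\<close>, so
    bit \<open>n\<close> differs after all.\<close>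
  have inj: "x = y" if "x \<in> X" "y \<in> X" "bit x = bit y" for x y
  proof (rule ccontr)
    assume "x \<noteq> y"
    then obtain n where n: "(x \<in> U n) \<noteq> (y \<in> U n)" using sep \<open>x \<in> X\<close> \<open>y \<in> X\<close> by blast
    have eq: "cell x n = cell y n" using cell_A that(3) by metis
    have "splits (cell x n) n"
      unfolding splits_def using n eq in_cell[OF \<open>x \<in> X\<close>, of n] in_cell[OF \<open>y \<in> X\<close>, of n] by blast
    then have "cut n (cell x n) = n" by (simp add: cut_def)
    then show False using n eq fun_cong[OF that(3), of n] unfolding bit_def by simp
  qed
  have loc: "bit y n = bit x n" if "y \<in> cell x (Suc n)" for x y n
  proof -
    have "y \<in> A (bit x) m" if "m \<le> Suc n" for m
      using A_dec[OF that, of "bit x"] \<open>y \<in> cell x (Suc n)\<close> by (auto simp: cell_A)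
    then show ?thesis using bit_A by blast
  qed
  \<comment> \<open>Bit \<open>n\<close> is constant on the open cell of level n+1 around a
    point.\<close>
  have cont: "continuous_on X (\<lambda>x. if bit x n then 2 else 0 :: real)" for n
    unfolding continuous_on_def
  proof
    fix x assume x: "x \<in> X"
    have "openin (top_of_set X) (cell x (Suc n))" using A_clopen cell_A by simp
    then obtain V where V: "open V" "cell x (Suc n) = X \<inter> V" by (auto simp: openin_open)
    have "\<forall>\<^sub>F y in at x within X. (if bit y n then 2 else 0 :: real) = (if bit x n then 2 else 0)"
      unfolding eventually_at_topological using V loc in_cell[OF x, of "Suc n"] by (intro exI[of _ V]) auto
    then show "((\<lambda>x. if bit x n then 2 else 0 :: real) \<longlongrightarrow> (if bit x n then 2 else 0)) (at x within X)"
      by (rule tendsto_eventually)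
  qed
  have "bij_betw bit X UNIV" using inj surj by (auto simp: bij_betw_def inj_on_def) (metis imageI)
  then have im: "(\<lambda>x. ternary_value (bit x)) ` X = cantor_ternary"
    unfolding cantor_ternary_eq_range by (metis bij_betw_def image_image)
  show ?thesis unfolding cantor_set_def
    by (rule homeomorphic_compact[OF X(1) continuous_on_ternary_value[OF cont] im])
       (intro inj_onI inj injD[OF inj_ternary_value])
qed

section \<open>A minimal map of the Cantor set with one branching point\<close>

lemma continuous_on_finite_coordinates:
  fixes g :: "(nat \<Rightarrow> nat) \<Rightarrow> 'b::topological_space"
  assumes "\<And>x y. (\<And>i. i \<le> n \<Longrightarrow> x i = y i) \<Longrightarrow> g x = g y"
  shows "continuous_on S g"
  unfolding continuous_on_def
proof
  fix x assume "x \<in> S"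
  \<comment> \<open>The digits are discrete, so the cylinder of sequences agreeing with
    \<open>x\<close> up to \<open>n\<close> is open, and \<open>g\<close> is constant on it.\<close>
  let ?W = "{y. \<forall>i\<in>{..n}. y i \<in> {x i}}"
  have "open ?W" by (rule product_topology_basis') (auto simp: open_discrete)
  moreover have "\<forall>y\<in>?W. g y = g x" by (auto intro: assms)
  ultimately have "\<forall>\<^sub>F y in at x within S. g y = g x"
    unfolding eventually_at_topological by (intro exI[of _ ?W]) blast
  then show "(g \<longlongrightarrow> g x) (at x within S)" by (rule tendsto_eventually)
qed

lemma open_contains_cylinder:
  fixes W :: "(nat \<Rightarrow> 'b::topological_space) set"
  assumes "open W" "x \<in> W"
  obtains n where "\<And>y. (\<And>i. i < n \<Longrightarrow> y i = x i) \<Longrightarrow> y \<in> W"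
proof -
  have "openin (product_topology (\<lambda>_. euclidean) UNIV) W"
    using assms(1) by (simp add: euclidean_product_topology)
  then obtain U where U: "finite {i. U i \<noteq> UNIV}" "x \<in> Pi\<^sub>E UNIV U" "Pi\<^sub>E UNIV U \<subseteq> W"
    using assms(2) unfolding openin_product_topology_alt by force
  obtain n where n: "\<forall>i\<in>{i. U i \<noteq> UNIV}. i < n"
    using U(1) unfolding finite_nat_set_iff_bounded ..
  have "y \<in> W" if y: "\<And>i. i < n \<Longrightarrow> y i = x i" for y
  proof -
    have "y i \<in> U i" for i
      using y[of i] n U(2) by (cases "U i = UNIV") auto
    then show ?thesis using U(3) by (auto simp: PiE_iff)
  qed
  then show ?thesis using that by blast
qed

text \<open>Paths in the Bratteli diagram with \<open>N\<close> vertices at each level in which the edges ending at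
  vertex \<open>j\<close> start, in this order, at \<open>0, \<dots>, N-1, j\<close>. A digit \<open>c < N\<close> stands for the \<open>c\<close>-th edge, which
  starts at vertex \<open>c\<close>, and a digit \<open>N + j\<close> for the last edge, from \<open>j\<close> to \<open>j\<close>. The successor (Vershik)
  map has one minimal path, and sends all \<open>N\<close> maximal paths \<open>N + j, N + j, \<dots>\<close> to it.\<close>

definition paths :: "nat \<Rightarrow> (nat \<Rightarrow> nat) set" where
  "paths N = {p. \<forall>n. p n < 2 * N \<and> (N \<le> p n \<longrightarrow> p (Suc n) mod N = p n mod N)}"

text \<open>Coordinatewise form: an initial run of last edges is reset to 0 and the first other edge
  is raised by one. The edge after \<open>N - 1\<close> is the last one into its end vertex, and
  that vertex is the start \<open>p (Suc k) mod N\<close> of the next edge; this is why coordinate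
  \<open>k\<close> also looks at coordinate k+1.\<close>

definition successor :: "nat \<Rightarrow> (nat \<Rightarrow> nat) \<Rightarrow> nat \<Rightarrow> nat" where
  "successor N p k =
     (if \<forall>i<k. N \<le> p i
      then if N \<le> p k then 0 else if Suc (p k) < N then Suc (p k) else N + p (Suc k) mod N
      else p k)"

lemma paths_less: "p \<in> paths N \<Longrightarrow> p n < 2 * N"
  and paths_mod: "p \<in> paths N \<Longrightarrow> N \<le> p n \<Longrightarrow> p (Suc n) mod N = p n mod N"
  by (auto simp: paths_def)

lemma paths_digit: "p \<in> paths N \<Longrightarrow> N \<le> p n \<Longrightarrow> p n = N + p (Suc n) mod N"
  using paths_less[of p N n] paths_mod[of p N n] by (simp add: le_mod_geq)

lemma zero_in_paths: "0 < N \<Longrightarrow> (\<lambda>_. 0) \<in> paths N"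
  by (simp add: paths_def)

lemma const_in_paths: "j < N \<Longrightarrow> (\<lambda>_. N + j) \<in> paths N"
  by (simp add: paths_def)

lemma successor_in_paths:
  assumes "p \<in> paths N" "0 < N"
  shows "successor N p \<in> paths N"
  unfolding paths_def
proof (intro CollectI allI conjI impI)
  fix n
  show "successor N p n < 2 * N"
    using paths_less[OF assms(1)] assms(2) by (auto simp: successor_def mult_2)
  assume "N \<le> successor N p n"
  then show "successor N p (Suc n) mod N = successor N p n mod N"
    using assms(2) paths_mod[OF assms(1), of n]
    by (auto simp: successor_def less_Suc_eq split: if_splits)
qed

lemma continuous_on_successor: "continuous_on S (successor N)"
proof (rule continuous_on_coordinatewise_then_product)
  fix k
  show "continuous_on S (\<lambda>p. successor N p k)"
  proof (rule continuous_on_finite_coordinates[of "Suc k"])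
    fix x y :: "nat \<Rightarrow> nat" assume eq: "\<And>i. i \<le> Suc k \<Longrightarrow> x i = y i"
    then have "(\<forall>i<k. N \<le> x i) \<longleftrightarrow> (\<forall>i<k. N \<le> y i)" by simp
    then show "successor N x k = successor N y k"
      unfolding successor_def using eq[of k] eq[of "Suc k"] by (simp cong: if_cong)
  qed
qed

lemma compact_paths: "compact (paths N)"
proof -
  let ?Q = "Pi\<^sub>E UNIV (\<lambda>_::nat. {..<2 * N})"
  have "compactin (product_topology (\<lambda>_::nat. euclidean) UNIV) ?Q"
    unfolding compactin_PiE by (simp add: finite_imp_compact)
  then have Q: "compact ?Q" by (simp add: euclidean_product_topology)
  have "closed {p::nat \<Rightarrow> nat. N \<le> p n \<longrightarrow> p (Suc n) mod N = p n mod N}" for n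
  proof -
    \<comment> \<open>The condition is a truth value depending on two coordinates, hence locally
      constant.\<close>
    have "continuous_on UNIV (\<lambda>p::nat \<Rightarrow> nat. (N \<le> p n \<longrightarrow> p (Suc n) mod N = p n mod N))"
      by (rule continuous_on_finite_coordinates[of "Suc n"]) simp
    then have "closed ((\<lambda>p::nat \<Rightarrow> nat. (N \<le> p n \<longrightarrow> p (Suc n) mod N = p n mod N)) -` {True})"
      by (intro closed_vimage) (auto simp: closed_def open_discrete)
    then show ?thesis by (simp add: vimage_def)
  qed
  then have "closed (\<Inter>n. {p::nat \<Rightarrow> nat. N \<le> p n \<longrightarrow> p (Suc n) mod N = p n mod N})" by blast
  then have "compact (?Q \<inter> (\<Inter>n. {p. N \<le> p n \<longrightarrow> p (Suc n) mod N = p n mod N}))"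
    by (rule compact_Int_closed[OF Q])
  moreover have "?Q \<inter> (\<Inter>n. {p. N \<le> p n \<longrightarrow> p (Suc n) mod N = p n mod N}) = paths N"
    by (auto simp: paths_def PiE_iff)
  ultimately show ?thesis by simp
qed

text \<open>Replacing digit \<open>n\<close> by \<open>p n mod N\<close> keeps the start vertex of
  that edge and frees the tail, since a digit below \<open>N\<close> may end at any vertex. The
  constant tails 0 and \<open>N\<close> then give two paths, and at most one of them is
  \<open>p\<close>.\<close>

lemma paths_not_isolated:
  assumes p: "p \<in> paths N" "0 < N"
  obtains q where "q \<in> paths N" "q \<noteq> p" "\<And>i. i < n \<Longrightarrow> q i = p i"
proof -
  define q where "q c i = (if i < n then p i else if i = n then p n mod N else c)" for c i
  have "q c \<in> paths N" if c: "c = 0 \<or> c = N" for c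
    unfolding paths_def
  proof (intro CollectI allI conjI impI)
    fix i
    have "p n mod N < 2 * N" using p(2) mod_less_divisor[of N "p n"] by linarith
    then show "q c i < 2 * N" using paths_less[OF p(1)] p(2) c by (auto simp: q_def)
    assume "N \<le> q c i"
    moreover have "\<not> N \<le> p n mod N" using p(2) by (simp add: not_le)
    ultimately consider "i < n" "N \<le> p i" | "i > n" by (auto simp: q_def split: if_splits)
    then show "q c (Suc i) mod N = q c i mod N"
    proof cases
      case 1
      then have "q c (Suc i) mod N = p (Suc i) mod N" by (cases "Suc i = n") (auto simp: q_def)
      then show ?thesis using 1 paths_mod[OF p(1), of i] by (simp add: q_def)
    qed (use c in \<open>auto simp: q_def\<close>)
  qed
  then have "q 0 \<in> paths N" "q N \<in> paths N" by auto
  moreover have "q 0 \<noteq> q N" 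
  proof
    assume "q 0 = q N"
    then have "q 0 (Suc n) = q N (Suc n)" by simp
    then show False using p(2) by (simp add: q_def)
  qed
  moreover have "q c i = p i" if "i < n" for c i using that by (simp add: q_def)
  ultimately show ?thesis using that by metis
qed

lemma cantor_set_paths:
  assumes "0 < N"
  shows "cantor_set (paths N)"
proof (rule clopen_separated_imp_cantor_set[where U = "\<lambda>m. {p. p (fst (prod_decode m)) = snd (prod_decode m)}"])
  show "compact (paths N)" by (rule compact_paths)
  show "paths N \<noteq> {}" using zero_in_paths[OF assms] by auto
  have vim: "{p::nat \<Rightarrow> nat. p i = c} = (\<lambda>p. p i) -` {c}" for i c by auto
  fix n
  have "open {p::nat \<Rightarrow> nat. p i = c}" "closed {p::nat \<Rightarrow> nat. p i = c}" for i c
    unfolding vim by (intro open_vimage closed_vimage; simp add: open_discrete closed_def open_discrete)+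
  then show "openin (top_of_set (paths N)) (paths N \<inter> {p. p (fst (prod_decode n)) = snd (prod_decode n)})"
    "closedin (top_of_set (paths N)) (paths N \<inter> {p. p (fst (prod_decode n)) = snd (prod_decode n)})"
    by (simp_all add: openin_open_Int closedin_closed_Int)
next
  fix x y :: "nat \<Rightarrow> nat" assume "x \<noteq> y"
  then obtain i where "x i \<noteq> y i" by auto
  then show "\<exists>n. (x \<in> {p. p (fst (prod_decode n)) = snd (prod_decode n)})
      \<noteq> (y \<in> {p. p (fst (prod_decode n)) = snd (prod_decode n)})"
    by (intro exI[of _ "prod_encode (i, x i)"]) auto
next
  fix x V assume x: "x \<in> V" and V: "openin (top_of_set (paths N)) V"
  obtain W where W: "open W" "V = paths N \<inter> W" using V by (auto simp: openin_open)
  obtain n where n: "\<And>y. (\<And>i. i < n \<Longrightarrow> y i = x i) \<Longrightarrow> y \<in> W"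
    using open_contains_cylinder[OF W(1), of x] x W(2) by auto
  obtain q where "q \<in> paths N" "q \<noteq> x" "\<And>i. i < n \<Longrightarrow> q i = x i"
    using paths_not_isolated[of x N n] x W(2) assms by auto
  then show "\<exists>y\<in>V. y \<noteq> x" using n W(2) by auto
qed

text \<open>A zero image forces every digit to be at least \<open>N\<close>, by induction on the
  position; the vertex condition then makes consecutive digits equal.\<close>

lemma successor_eq_zero_iff:
  assumes "p \<in> paths N" "0 < N"
  shows "successor N p = (\<lambda>_. 0) \<longleftrightarrow> (\<exists>j<N. p = (\<lambda>_. N + j))"
proof
  assume z: "successor N p = (\<lambda>_. 0)"
  have all: "N \<le> p k" for k
  proof (induction k rule: less_induct)
    case (less k)
    then show ?case using fun_cong[OF z, of k] assms(2) by (auto simp: successor_def split: if_splits)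
  qed
  have "p k = p 0" for k
  proof (induction k)
    case (Suc k)
    then show ?case
      using paths_mod[OF assms(1) all, of k] paths_less[OF assms(1)] all[of k] all[of "Suc k"]
        paths_less[OF assms(1), of k] paths_less[OF assms(1), of "Suc k"]
      by (simp add: le_mod_geq)
  qed simp
  then show "\<exists>j<N. p = (\<lambda>_. N + j)"
    using all[of 0] paths_less[OF assms(1), of 0] by (intro exI[of _ "p 0 - N"]) auto
qed (auto simp: successor_def)

text \<open>The length \<open>n\<close> of the initial run of last edges is visible in the image as
  the number of leading zeros. This is what allows the successor map to be inverted away from the
  zero path.\<close>

lemma successor_leading_zeros:
  assumes "successor N p \<noteq> (\<lambda>_. 0)" "0 < N"
  obtains n where "p n < N" "\<And>i. i < n \<Longrightarrow> N \<le> p i" "\<And>i. i < n \<Longrightarrow> successor N p i = 0"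
    "successor N p n \<noteq> 0" "\<And>i. n < i \<Longrightarrow> successor N p i = p i"
proof -
  have "\<exists>n. p n < N"
  proof (rule ccontr)
    assume "\<not> ?thesis"
    then have "successor N p k = 0" for k by (simp add: successor_def not_less)
    then show False using assms(1) by auto
  qed
  then obtain n where n: "p n < N" "\<And>i. i < n \<Longrightarrow> N \<le> p i" using exists_least_iff[of "\<lambda>n. p n < N"] by (auto simp: not_less)
  show ?thesis
  proof (rule that[of n])
    show "successor N p i = 0" if "i < n" for i using n(2) that by (auto simp: successor_def)
    show "successor N p n \<noteq> 0" using n assms(2) by (auto simp: successor_def)
    show "successor N p i = p i" if "n < i" for i
      using n(1) that by (auto simp: successor_def not_le)
  qed (use n in auto)
qed

text \<open>The leading zeros of the common image determine \<open>n\<close>. Later digits are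
  unchanged and digit \<open>n\<close> is found by stepping back once. The earlier digits are
  recovered from right to left, because a digit that is at least \<open>N\<close> is determined by
  the next one.\<close>

lemma successor_inj:
  assumes p: "p \<in> paths N" "q \<in> paths N" "0 < N"
    and eq: "successor N p = successor N q" and nz: "successor N p \<noteq> (\<lambda>_. 0)"
  shows "p = q"
proof -
  obtain n where n: "p n < N" "\<And>i. i < n \<Longrightarrow> N \<le> p i" "\<And>i. i < n \<Longrightarrow> successor N p i = 0"
    "successor N p n \<noteq> 0" "\<And>i. n < i \<Longrightarrow> successor N p i = p i"
    using successor_leading_zeros[OF nz p(3)] by metis
  obtain m where m: "q m < N" "\<And>i. i < m \<Longrightarrow> N \<le> q i" "\<And>i. i < m \<Longrightarrow> successor N q i = 0"
    "successor N q m \<noteq> 0" "\<And>i. m < i \<Longrightarrow> successor N q i = q i"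
    using successor_leading_zeros[of N q] nz p(3) eq by metis
  have [simp]: "m = n" using n(3,4) m(3,4) eq by (metis linorder_neqE_nat)
  have gt: "p i = q i" if "n < i" for i using n(5) m(5) eq that by simp
  have "successor N p n = (if Suc (p n) < N then Suc (p n) else N + p (Suc n) mod N)"
    "successor N q n = (if Suc (q n) < N then Suc (q n) else N + q (Suc n) mod N)"
    using n(1,2) m(1,2) by (auto simp: successor_def)
  then have pn: "p n = q n" using n(1) m(1) eq by (auto split: if_splits)
  have "p (n - k) = q (n - k)" for k
  proof (induction k)
    case (Suc k)
    show ?case
    proof (cases "k < n")
      case True
      then have lt: "n - Suc k < n" and S: "Suc (n - Suc k) = n - k" by auto
      show ?thesis
        using paths_digit[OF p(1) n(2)[OF lt]] paths_digit[OF p(2) m(2)[of "n - Suc k"]] lt Suc S by simp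
    qed (use Suc in simp)
  qed (simp add: pn)
  then have "p i = q i" if "i \<le> n" for i using that by (metis diff_diff_cancel)
  then show ?thesis using gt by (metis ext not_less)
qed

text \<open>Position in the tower of height \<open>(N + 1) ^ n\<close>: the successor map acts on it as an odometer.\<close>

definition tower_rank :: "nat \<Rightarrow> nat \<Rightarrow> (nat \<Rightarrow> nat) \<Rightarrow> nat" where
  "tower_rank N n p = (\<Sum>i<n. min (p i) N * Suc N ^ i)"

lemma tower_rank_Suc: "tower_rank N (Suc n) p = tower_rank N n p + min (p n) N * Suc N ^ n"
  by (simp add: tower_rank_def)

lemma tower_rank_less: "tower_rank N n p < Suc N ^ n"
proof (induction n)
  case (Suc n)
  have "min (p n) N * Suc N ^ n \<le> N * Suc N ^ n" by (rule mult_right_mono) auto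
  then show ?case using Suc unfolding tower_rank_Suc power_Suc mult_Suc by linarith
qed (simp add: tower_rank_def)

text \<open>Ranks are expansions in base N+1 with digits \<open>min (p i) N\<close>; division by
  \<open>Suc N ^ n\<close> splits off the top digit.\<close>

lemma tower_rank_eqD:
  assumes "tower_rank N n p = tower_rank N n q" "i < n"
  shows "min (p i) N = min (q i) N"
  using assms
proof (induction n)
  case (Suc n)
  have "tower_rank N (Suc n) p mod Suc N ^ n = tower_rank N n p" "tower_rank N (Suc n) p div Suc N ^ n = min (p n) N" for p
    using tower_rank_less[of N n p] by (simp_all add: tower_rank_Suc)
  then have "tower_rank N n p = tower_rank N n q" "min (p n) N = min (q n) N" using Suc.prems(1) by metis+
  then show ?case using Suc by (auto simp: less_Suc_eq)
qed simp

lemma tower_rank_full: "\<forall>i<n. N \<le> p i \<Longrightarrow> Suc (tower_rank N n p) = Suc N ^ n"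
  by (induction n) (simp_all add: tower_rank_def)

text \<open>Addition of one with carry. Truncation at \<open>N\<close> forgets the end vertex, so
  passing from \<open>N - 1\<close> to \<open>N + j\<close> also counts as an increase by
  one.\<close>

lemma tower_rank_successor:
  "tower_rank N n (successor N p) = (if \<forall>i<n. N \<le> p i then 0 else Suc (tower_rank N n p))"
proof (induction n)
  case (Suc n)
  show ?case
  proof (cases "\<forall>i<n. N \<le> p i")
    case True
    then have r: "tower_rank N n (successor N p) = 0" using Suc by simp
    show ?thesis
    proof (cases "N \<le> p n")
      case True2: True
      then have "\<forall>i<Suc n. N \<le> p i" using True by (simp add: less_Suc_eq)
      moreover have "successor N p n = 0" using True True2 by (simp add: successor_def)
      ultimately show ?thesis using r by (simp add: tower_rank_Suc)
    next
      case False
      then have "min (successor N p n) N = Suc (p n)" using True by (auto simp: successor_def)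
      then show ?thesis using False r tower_rank_full[OF True] by (auto simp: tower_rank_Suc)
    qed
  next
    case False
    then have "successor N p n = p n" by (auto simp: successor_def)
    moreover have "\<not> (\<forall>i<Suc n. N \<le> p i)" using False less_SucI by blast
    ultimately show ?thesis using Suc False by (simp add: tower_rank_Suc)
  qed
qed (simp add: tower_rank_def)

lemma tower_rank_successor_mod: "tower_rank N n (successor N p) = Suc (tower_rank N n p) mod Suc N ^ n"
proof (cases "\<forall>i<n. N \<le> p i")
  case True
  then show ?thesis using tower_rank_full[OF True] by (simp add: tower_rank_successor)
next
  case False
  then have "tower_rank N n (successor N p) = Suc (tower_rank N n p)" using tower_rank_successor[of N n p] by (simp only: if_False)
  then show ?thesis using tower_rank_less[of N n "successor N p"] by simp
qed

lemma tower_rank_funpow: "tower_rank N n ((successor N ^^ m) p) = (tower_rank N n p + m) mod Suc N ^ n"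
proof (induction m)
  case 0
  then show ?case using tower_rank_less[of N n p] by simp
next
  case (Suc m)
  then show ?case by (simp only: funpow.simps o_apply tower_rank_successor_mod add_Suc_right mod_Suc_eq)
qed

text \<open>The rank shows digits only up to truncation at \<open>N\<close>. Prescribing digit
  \<open>n\<close> to be below \<open>N\<close> fixes a start vertex exactly, and from there the
  truncated digits are restored from right to left by the vertex condition.\<close>

lemma tower_rank_determines_prefix:
  assumes p: "p \<in> paths N" "w \<in> paths N" "0 < N"
    and r: "tower_rank N (Suc n) p = tower_rank N n w + (w n mod N) * Suc N ^ n"
  shows "i < n \<Longrightarrow> p i = w i"
proof -
  \<comment> \<open>Edge \<open>n\<close> of \<open>w\<close> is replaced by one with the same start
    whose digit survives truncation.\<close>
  define w' where "w' i = (if i = n then w n mod N else w i)" for i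
  have wn: "w n mod N < N" using p(3) by simp
  have "tower_rank N (Suc n) w' = tower_rank N n w + (w n mod N) * Suc N ^ n"
    using wn by (simp add: tower_rank_Suc w'_def) (simp add: tower_rank_def w'_def)
  then have e: "min (p i) N = min (w' i) N" if "i \<le> n" for i
    using tower_rank_eqD[of N "Suc n" p w' i] r that by simp
  have main: "p (n - k) mod N = w (n - k) mod N \<and> (0 < k \<longrightarrow> p (n - k) = w (n - k))" if "k \<le> n" for k
    using that
  proof (induction k)
    case 0
    have "min (p n) N = w n mod N" using e[of n] wn by (simp add: w'_def)
    then have "p n = w n mod N" using wn by linarith
    then show ?case by simp
  next
    case (Suc k)
    have S: "Suc (n - Suc k) = n - k" using Suc.prems by simp
    have eq: "min (p (n - Suc k)) N = min (w (n - Suc k)) N" using e[of "n - Suc k"] Suc.prems by (simp add: w'_def)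
    have "p (n - Suc k) = w (n - Suc k)"
    proof (cases "N \<le> p (n - Suc k)")
      case True
      then have "N \<le> w (n - Suc k)" using eq by linarith
      then show ?thesis
        using paths_digit[OF p(1) True] paths_digit[OF p(2), of "n - Suc k"] Suc S by simp
    qed (use eq in linarith)
    then show ?case by simp
  qed
  show "i < n \<Longrightarrow> p i = w i" using main[of "n - i"] by simp
qed

text \<open>The rank advances by one modulo \<open>q\<close>, so the orbit returns to the rank
  \<open>W\<close>, and with it to the cylinder of \<open>w\<close>, at every \<open>q\<close>-th
  step. The arithmetic progression is kept so that a rotation can be controlled at the same
  times.\<close>

lemma successor_visits:
  assumes p: "p \<in> paths N" and w: "w \<in> paths N" and N: "0 < N"
  obtains q r where "0 < q" "\<forall>m. \<forall>i<n. (successor N ^^ (r + q * m)) p i = w i"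
proof -
  define q where "q = Suc N ^ Suc n"
  define W where "W = tower_rank N n w + (w n mod N) * Suc N ^ n"
  have q: "0 < q" by (simp add: q_def)
  have "w n mod N \<le> N" using N by (simp add: less_imp_le)
  then have "(w n mod N) * Suc N ^ n \<le> N * Suc N ^ n" by (rule mult_right_mono) simp
  then have W: "W < q" using tower_rank_less[of N n w] unfolding W_def q_def power_Suc mult_Suc by linarith
  \<comment> \<open>Adding \<open>q\<close> before subtracting the rank of \<open>p\<close> keeps
    \<open>r\<close> a natural number, and the rank of \<open>p\<close> plus \<open>r\<close> is
    \<open>W\<close> modulo \<open>q\<close>.\<close>
  define r where "r = W + (q - tower_rank N (Suc n) p)"
  have rp: "tower_rank N (Suc n) p < q" using tower_rank_less[of N "Suc n" p] by (simp add: q_def)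
  have it: "(successor N ^^ m) p \<in> paths N" for m
    by (induction m) (auto intro: successor_in_paths p N)
  have "tower_rank N (Suc n) ((successor N ^^ (r + q * m)) p) = W" for m
  proof -
    have "tower_rank N (Suc n) p + (r + q * m) = W + q * (m + 1)" using rp by (simp add: r_def algebra_simps)
    then have "(tower_rank N (Suc n) p + (r + q * m)) mod q = W mod q" by (simp only: mod_mult_self2)
    then show ?thesis using W by (simp add: tower_rank_funpow q_def)
  qed
  then have "(successor N ^^ (r + q * m)) p i = w i" if "i < n" for m i
    using tower_rank_determines_prefix[OF it w N _ that] unfolding W_def by blast
  then show ?thesis using that q by blast
qed

text \<open>The successor map, transported to the ternary Cantor set, with \<open>b\<close> the zero
  path. The last conclusion strengthens the density of orbits: visits along a whole arithmetic
  progression leave a free parameter for the rotation.\<close>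

lemma cantor_minimal_map_with_branching:
  assumes "0 < N"
  obtains B :: "real set" and f :: "real \<Rightarrow> real" and b :: real and idx :: "real \<Rightarrow> nat"
  where "cantor_set B" "compact B" "continuous_on B f" "f ` B \<subseteq> B" "b \<in> B"
    "continuous_on B idx" "idx ` B \<subseteq> {..<N}" "idx ` {x \<in> B. f x = b} = {..<N}"
    "\<forall>x\<in>B. \<forall>y\<in>B. f x = f y \<longrightarrow> f x \<noteq> b \<longrightarrow> x = y"
    "\<forall>x\<in>B. \<forall>y\<in>B. \<forall>U. open U \<longrightarrow> y \<in> U
       \<longrightarrow> (\<exists>r q. 0 < q \<and> (\<forall>m. (f ^^ (r + q * m)) x \<in> U))"
proof -
  let ?S = "successor N"
  obtain g h where gh: "homeomorphism (paths N) cantor_ternary g h"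
    using cantor_set_paths[OF assms] by (auto simp: cantor_set_def homeomorphic_def)
  have hg: "h (g p) = p" "g p \<in> cantor_ternary" if "p \<in> paths N" for p
    using gh that by (auto simp: homeomorphism_def)
  have g_h: "g (h x) = x" "h x \<in> paths N" if "x \<in> cantor_ternary" for x
    using gh that by (auto simp: homeomorphism_def)
  have cg: "continuous_on (paths N) g" and ch: "continuous_on cantor_ternary h"
    using gh by (auto simp: homeomorphism_def)
  have Sp: "?S p \<in> paths N" if "p \<in> paths N" for p using successor_in_paths that assms by blast
  have Sm: "(?S ^^ m) p \<in> paths N" if "p \<in> paths N" for p m
    by (induction m) (use that Sp in auto)
  define f where "f = g \<circ> ?S \<circ> h"
  \<comment> \<open>The start vertex of the first edge; on the preimage
    \<open>N + j, N + j, ...\<close> of \<open>b\<close> it is \<open>j\<close>.\<close>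
  define idx where "idx = (\<lambda>x. h x 0 mod N)"
  define b where "b = g (\<lambda>_. 0)"
  note z = zero_in_paths[OF assms]
  have f_pow: "(f ^^ m) (g p) = g ((?S ^^ m) p)" if "p \<in> paths N" for p m
    by (induction m) (use that Sm hg in \<open>auto simp: f_def\<close>)
  have f_eq_b: "f x = b \<longleftrightarrow> ?S (h x) = (\<lambda>_. 0)" if "x \<in> cantor_ternary" for x
    unfolding f_def b_def comp_def using hg(1)[OF Sp[OF g_h(2)[OF that]]] hg(1)[OF z] by metis
  show ?thesis
  proof (rule that[of cantor_ternary f b idx])
    show "cantor_set cantor_ternary" by (simp add: cantor_set_def homeomorphic_refl)
    show "compact cantor_ternary"
      using compact_continuous_image[OF cg compact_paths] gh by (simp add: homeomorphism_def)
    show "continuous_on cantor_ternary f"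
      unfolding f_def
      by (intro continuous_on_compose ch continuous_on_successor continuous_on_subset[OF cg])
         (use g_h Sp in auto)
    show "f ` cantor_ternary \<subseteq> cantor_ternary" using g_h Sp hg by (auto simp: f_def)
    show "b \<in> cantor_ternary" using z hg by (simp add: b_def)
    have "continuous_on UNIV (\<lambda>p::nat \<Rightarrow> nat. p 0 mod N)"
      by (rule continuous_on_finite_coordinates[of 0]) simp
    then show "continuous_on cantor_ternary idx"
      unfolding idx_def using ch by (rule continuous_on_compose2) simp
    show "idx ` cantor_ternary \<subseteq> {..<N}" using assms by (auto simp: idx_def)
    then have "idx ` {x \<in> cantor_ternary. f x = b} \<subseteq> {..<N}" by blast
    moreover have "j \<in> idx ` {x \<in> cantor_ternary. f x = b}" if "j < N" for j
    proof -
      note c = const_in_paths[OF that]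
      have "?S (\<lambda>_. N + j) = (\<lambda>_. 0)" using successor_eq_zero_iff[OF c assms] that by blast
      then have "f (g (\<lambda>_. N + j)) = b" using f_eq_b[OF hg(2)[OF c]] hg(1)[OF c] by simp
      moreover have "idx (g (\<lambda>_. N + j)) = j" using hg(1)[OF c] that by (simp add: idx_def)
      ultimately show ?thesis using hg(2)[OF c] by force
    qed
    ultimately show "idx ` {x \<in> cantor_ternary. f x = b} = {..<N}" by auto
    have "x = y" if "x \<in> cantor_ternary" "y \<in> cantor_ternary" "f x = f y" "f x \<noteq> b" for x y
    proof -
      have "?S (h x) = ?S (h y)" using that(3) hg(1) Sp g_h(2) that(1,2) unfolding f_def comp_def by metis
      then have "h x = h y" using successor_inj[OF g_h(2) g_h(2) assms] that f_eq_b by blast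
      then show ?thesis using g_h(1) that(1,2) by metis
    qed
    then show "\<forall>x\<in>cantor_ternary. \<forall>y\<in>cantor_ternary. f x = f y \<longrightarrow> f x \<noteq> b \<longrightarrow> x = y" by blast
    have "\<exists>r q. 0 < q \<and> (\<forall>m. (f ^^ (r + q * m)) x \<in> U)"
      if x: "x \<in> cantor_ternary" "y \<in> cantor_ternary" and U: "open U" "y \<in> U" for x y U
    proof -
      obtain W where W: "open W" "W \<inter> paths N = g -` U \<inter> paths N"
        using continuous_on_open_invariant[of "paths N" g] cg U(1) by blast
      have "h y \<in> W" using W(2) g_h[OF x(2)] U(2) by auto
      then obtain n where n: "\<And>p. (\<And>i. i < n \<Longrightarrow> p i = h y i) \<Longrightarrow> p \<in> W"
        using open_contains_cylinder[OF W(1)] by blast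
      obtain q r where rq: "0 < q" "\<forall>m. \<forall>i<n. (?S ^^ (r + q * m)) (h x) i = h y i"
        by (rule successor_visits[OF g_h(2)[OF x(1)] g_h(2)[OF x(2)] assms, of n])
      have "(f ^^ (r + q * m)) x \<in> U" for m
      proof -
        have "(?S ^^ (r + q * m)) (h x) \<in> W \<inter> paths N" using n rq(2) Sm[OF g_h(2)[OF x(1)]] by blast
        then have "g ((?S ^^ (r + q * m)) (h x)) \<in> U" using W(2) by blast
        then show ?thesis using f_pow[OF g_h(2)[OF x(1)], of "r + q * m"] g_h(1)[OF x(1)] by simp
      qed
      then show ?thesis using rq(1) by blast
    qed
    then show "\<forall>x\<in>cantor_ternary. \<forall>y\<in>cantor_ternary. \<forall>U. open U \<longrightarrow> y \<in> U
       \<longrightarrow> (\<exists>r q. 0 < q \<and> (\<forall>m. (f ^^ (r + q * m)) x \<in> U))" by blast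
  qed
qed

section \<open>Density of the orbits of an irrational rotation along progressions\<close>

lemma irrational_rotation_exists:
  obtains \<rho> :: complex where "norm \<rho> = 1"
    "\<forall>q w e. 0 < q \<longrightarrow> norm w = 1 \<longrightarrow> 0 < e \<longrightarrow> (\<exists>m. dist (\<rho> ^ (q * m)) w < e)"
proof -
  obtain \<theta> :: real where \<theta>: "\<theta> \<notin> \<rat>"
    using countable_rat uncountable_UNIV_real by (metis UNIV_eq_I)
  show ?thesis
  proof (rule that[of "cis (2 * pi * \<theta>)"])
    have "\<exists>m. dist (cis (2 * pi * \<theta>) ^ (q * m)) w < e"
      if q: "0 < q" and w: "norm w = 1" and e: "0 < e" for q :: nat and w :: complex and e :: real
    proof -
      \<comment> \<open>A positive multiple of an irrational angle is irrational, so Kronecker's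
        theorem applies to every power of the rotation.\<close>
      have q\<theta>: "real q * \<theta> \<notin> \<rat>"
      proof
        assume "real q * \<theta> \<in> \<rat>"
        then have "(real q * \<theta>) / real q \<in> \<rat>" by (intro Rats_divide) auto
        then show False using q \<theta> by simp
      qed
      obtain t where t: "0 \<le> t" "t < 2 * pi" "w = cis t"
        using Arg2pi_eq[of w] Arg2pi_ge_0[of w] Arg2pi_lt_2pi[of w] w
        by (auto simp: cis_conv_exp)
      have "isCont (\<lambda>s. cis (2 * pi * s)) (t / (2 * pi))"
        unfolding cis_conv_exp by (intro continuous_intros)
      then obtain d where d: "0 < d"
        "\<And>s. dist s (t / (2 * pi)) < d \<Longrightarrow> dist (cis (2 * pi * s)) (cis (2 * pi * (t / (2 * pi)))) < e"
        using e unfolding continuous_at_eps_delta by metis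
      obtain k where k: "\<bar>frac (real k * (real q * \<theta>)) - t / (2 * pi)\<bar> < d"
        using Kronecker_approx_1_explicit[OF q\<theta>, of "t / (2 * pi)" d] t d(1) by (auto simp: field_simps)
      have "cis (2 * pi * \<theta>) ^ (q * k) = cis (2 * pi * (real k * (real q * \<theta>)))"
        unfolding Complex.DeMoivre by (rule arg_cong[where f = cis]) simp
      also have "\<dots> = cis (2 * pi * frac (real k * (real q * \<theta>)) + 2 * pi * of_int \<lfloor>real k * (real q * \<theta>)\<rfloor>)"
        by (simp add: frac_def algebra_simps)
      also have "\<dots> = cis (2 * pi * frac (real k * (real q * \<theta>)))"
        by (simp add: cis_mult[symmetric] cis_multiple_2pi)
      finally have "cis (2 * pi * \<theta>) ^ (q * k) = cis (2 * pi * frac (real k * (real q * \<theta>)))" .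
      then show ?thesis
        using d(2)[of "frac (real k * (real q * \<theta>))"] k t(3) by (intro exI[of _ k]) (simp add: dist_real_def)
    qed
    then show "\<forall>q w e. 0 < q \<longrightarrow> norm w = 1 \<longrightarrow> 0 < e \<longrightarrow> (\<exists>m. dist (cis (2 * pi * \<theta>) ^ (q * m)) w < e)"
      by blast
  qed simp
qed

section \<open>Skew products from sections of a map onto the circle\<close>

lemma skew_system_from_sections:
  fixes \<Gamma> :: "(real^3) set" and h :: "real^3 \<Rightarrow> complex" and s :: "nat \<Rightarrow> complex \<Rightarrow> real^3"
  assumes \<Gamma>: "is_graph \<Gamma>" "connected \<Gamma>" and N: "0 < N"
    and h: "continuous_on \<Gamma> h" "\<And>x. x \<in> \<Gamma> \<Longrightarrow> norm (h x) = 1"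
    and s: "\<And>k. k < N \<Longrightarrow> continuous_on (sphere 0 1) (s k)"
    and s\<Gamma>: "\<And>k w. k < N \<Longrightarrow> norm w = 1 \<Longrightarrow> s k w \<in> \<Gamma>"
    and hs: "\<And>k w. k < N \<Longrightarrow> norm w = 1 \<Longrightarrow> h (s k w) = w"
  obtains B f F M b where "skew_system B f \<Gamma> F M b"
    "M \<inter> ({b} \<times> \<Gamma>) = {b} \<times> (\<Union>k<N. s k ` sphere 0 1)"
proof -
  let ?C = "sphere (0::complex) 1"
  obtain B :: "real set" and f :: "real \<Rightarrow> real" and b :: real and idx :: "real \<Rightarrow> nat" where
    B: "cantor_set B" "compact B" and cf: "continuous_on B f" and fB: "f ` B \<subseteq> B" and b: "b \<in> B"
    and idx: "continuous_on B idx" "idx ` B \<subseteq> {..<N}" "idx ` {x \<in> B. f x = b} = {..<N}"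
    and inj: "\<forall>x\<in>B. \<forall>y\<in>B. f x = f y \<longrightarrow> f x \<noteq> b \<longrightarrow> x = y"
    and visit: "\<forall>x\<in>B. \<forall>y\<in>B. \<forall>U. open U \<longrightarrow> y \<in> U
       \<longrightarrow> (\<exists>r q. 0 < q \<and> (\<forall>m. (f ^^ (r + q * m)) x \<in> U))"
    by (rule cantor_minimal_map_with_branching[OF N])
  obtain \<rho> :: complex where \<rho>: "norm \<rho> = 1"
    and dense: "\<forall>q w e. 0 < q \<longrightarrow> norm w = 1 \<longrightarrow> 0 < e \<longrightarrow> (\<exists>m. dist (\<rho> ^ (q * m)) w < e)"
    by (rule irrational_rotation_exists)
  have fpow: "(f ^^ n) z \<in> B" if "z \<in> B" for n z
    by (induction n) (use that fB in auto)
  have idxN: "idx z < N" if "z \<in> B" for z using idx(2) that by auto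
  \<comment> \<open>Minimality of the product of \<open>f\<close> and the rotation: the times r + q
    m keep the first coordinate near \<open>z\<close> for every \<open>m\<close>, and density of the
    powers \<open>\<rho> ^ (q * m)\<close> then selects \<open>m\<close> so that the second
    coordinate is near \<open>w\<close>.\<close>
  have full: "L = B \<times> ?C" if L: "L \<subseteq> B \<times> ?C" "closed L" "L \<noteq> {}"
    and inv: "\<And>z w. (z, w) \<in> L \<Longrightarrow> (f z, \<rho> * w) \<in> L" for L :: "(real \<times> complex) set"
  proof (rule antisym[OF L(1)], rule subrelI)
    fix z w assume zw: "(z, w) \<in> B \<times> ?C"
    obtain z0 w0 where zw0: "(z0, w0) \<in> L" using L(3) by auto
    then have z0: "z0 \<in> B" "norm w0 = 1" using L(1) by auto
    have orb: "((f ^^ n) z0, \<rho> ^ n * w0) \<in> L" for n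
    proof (induction n)
      case (Suc n)
      then show ?case using inv[OF Suc] by (simp add: mult_ac)
    qed (use zw0 in simp)
    have "(z, w) \<in> closure L"
      unfolding closure_approachable
    proof (intro allI impI)
      fix e :: real assume e: "0 < e"
      obtain r q where rq: "0 < q" "\<And>m. (f ^^ (r + q * m)) z0 \<in> ball z (e / 2)"
        using visit[rule_format, OF z0(1), of z "ball z (e / 2)"] zw e by auto
      have nz: "w0 \<noteq> 0" "\<rho> \<noteq> 0" using z0(2) \<rho> by auto
      have "norm (w / (\<rho> ^ r * w0)) = 1" using zw z0(2) \<rho> by (simp add: norm_divide norm_mult norm_power)
      then obtain m where m: "dist (\<rho> ^ (q * m)) (w / (\<rho> ^ r * w0)) < e / 2"
        using dense[rule_format, OF rq(1), of "w / (\<rho> ^ r * w0)" "e / 2"] e by auto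
      have "dist (\<rho> ^ (r + q * m) * w0) w = norm ((\<rho> ^ r * w0) * (\<rho> ^ (q * m) - w / (\<rho> ^ r * w0)))"
        using nz by (simp add: dist_norm power_add algebra_simps)
      also have "\<dots> < e / 2" using m z0(2) \<rho> by (simp add: norm_mult norm_power dist_norm)
      finally have w: "dist (\<rho> ^ (r + q * m) * w0) w < e / 2" .
      have "dist ((f ^^ (r + q * m)) z0, \<rho> ^ (r + q * m) * w0) (z, w)
          \<le> dist ((f ^^ (r + q * m)) z0) z + dist (\<rho> ^ (r + q * m) * w0) w"
        unfolding dist_prod_def by (simp add: sqrt_sum_squares_le_sum)
      also have "\<dots> < e" using w rq(2)[of m] by (simp add: dist_commute)
      finally show "\<exists>y\<in>L. dist y (z, w) < e" using orb by blast
    qed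
    then show "(z, w) \<in> L" using L(2) by simp
  qed
  \<comment> \<open>A closed invariant \<open>K\<close> for \<open>f\<close> gives the invariant set
    \<open>K \<times> ?C\<close> of the product.\<close>
  have min_f: "K = B" if K: "K \<subseteq> B" "closed K" "K \<noteq> {}" "f ` K \<subseteq> K" for K
  proof -
    have "K \<times> ?C = B \<times> ?C"
      by (rule full) (use K \<rho> in \<open>auto intro: closed_Times simp: norm_mult\<close>)
    moreover have "?C \<noteq> {}" by simp
    ultimately show ?thesis by (metis Times_eq_cancel2 ex_in_conv)
  qed
  have surj: "f ` B = B"
    by (rule min_f) (use fB b compact_continuous_image[OF cf B(2)] in \<open>auto intro: compact_imp_closed\<close>)
  define F where "F = (\<lambda>(z, x). (f z, s (idx z) (\<rho> * h x)))"
  define M where "M = {(f z, s (idx z) w) | z w. z \<in> B \<and> w \<in> ?C}"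
  \<comment> \<open>The index is locally constant, so \<open>B\<close> splits into finitely many
    closed pieces, on each of which a single section is used.\<close>
  have pieces: "closed {z \<in> B. idx z = k}" for k
    using continuous_closed_preimage_constant[OF idx(1) compact_imp_closed[OF B(2)], of k] by simp
  \<comment> \<open>Stated for a general \<open>u\<close>: the choice \<open>\<rho> * h x\<close>
    gives continuity of \<open>F\<close>, the identity gives compactness of
    \<open>M\<close>.\<close>
  have cont_pieces: "continuous_on (B \<times> X) (\<lambda>(z, x). (f z, s (idx z) (u x)))"
    if u: "continuous_on X u" "u ` X \<subseteq> ?C" and X: "closed X" for X :: "'z::topological_space set" and u
  proof -
    have "continuous_on ({z \<in> B. idx z = k} \<times> X) (\<lambda>(z, x). (f z, s (idx z) (u x)))" if k: "k < N" for k
    proof -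
      have "continuous_on ({z \<in> B. idx z = k} \<times> X) (\<lambda>p. (f (fst p), s k (u (snd p))))"
        by (intro continuous_on_Pair continuous_on_compose2[OF cf] continuous_on_compose2[OF s[OF k]]
            continuous_on_compose2[OF u(1)] continuous_on_fst continuous_on_snd continuous_on_id)
           (use u(2) in auto)
      then show ?thesis by (rule continuous_on_eq) auto
    qed
    then have "continuous_on (\<Union>k\<in>{..<N}. {z \<in> B. idx z = k} \<times> X) (\<lambda>(z, x). (f z, s (idx z) (u x)))"
      by (intro continuous_on_closed_Union closed_Times pieces X) auto
    moreover have "(\<Union>k\<in>{..<N}. {z \<in> B. idx z = k} \<times> X) = B \<times> X" using idxN by auto
    ultimately show ?thesis by simp
  qed
  have \<Gamma>_closed: "closed \<Gamma>"
    using \<Gamma>(1) unfolding is_graph_def by (auto intro!: closed_path_image arc_imp_path)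
  have cF: "continuous_on (B \<times> \<Gamma>) F"
    unfolding F_def
    by (rule cont_pieces[of \<Gamma> "\<lambda>x. \<rho> * h x"]) (use h \<Gamma>_closed \<rho> in \<open>auto intro!: continuous_intros simp: norm_mult\<close>)
  have M_im: "M = (\<lambda>(z, w). (f z, s (idx z) w)) ` (B \<times> ?C)" by (auto simp: M_def) blast
  have M_comp: "compact M"
    unfolding M_im
    by (intro compact_continuous_image compact_Times B(2) compact_sphere cont_pieces[of ?C "\<lambda>w. w"]) auto
  have F_im: "F ` (B \<times> \<Gamma>) \<subseteq> M"
  proof (rule image_subsetI)
    fix p assume "p \<in> B \<times> \<Gamma>"
    then obtain z x where p: "p = (z, x)" and zx: "z \<in> B" "x \<in> \<Gamma>" by auto
    then have "\<rho> * h x \<in> ?C" using h(2) \<rho> by (simp add: norm_mult)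
    then show "F p \<in> M" using zx unfolding p F_def M_def prod.case by blast
  qed
  have M_sub: "M \<subseteq> B \<times> \<Gamma>" using fB s\<Gamma> idxN by (auto simp: M_def)
  have M_min: "K = M" if K: "K \<subseteq> M" "closed K" "K \<noteq> {}" "F ` K \<subseteq> K" for K
  proof (rule antisym[OF K(1)])
    let ?\<pi> = "\<lambda>(z, x). (z, h x)"
    have K\<Gamma>: "K \<subseteq> B \<times> \<Gamma>" using K(1) M_sub by blast
    have compK: "compact K" using M_comp K(1,2) by (metis compact_Int_closed inf.absorb2)
    have c\<pi>: "continuous_on K ?\<pi>"
    proof -
      have "continuous_on K (\<lambda>p. (fst p, h (snd p)))"
        by (intro continuous_on_Pair continuous_on_fst continuous_on_snd continuous_on_id
            continuous_on_compose2[OF h(1)]) (use K\<Gamma> in auto)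
      then show ?thesis by (simp add: case_prod_unfold)
    qed
    have \<pi>K: "?\<pi> ` K = B \<times> ?C"
    proof (rule full)
      show "?\<pi> ` K \<subseteq> B \<times> ?C" using K\<Gamma> h(2) by auto
      show "closed (?\<pi> ` K)" using compact_continuous_image[OF c\<pi> compK] by (rule compact_imp_closed)
      show "?\<pi> ` K \<noteq> {}" using K(3) by simp
      fix z w assume "(z, w) \<in> ?\<pi> ` K"
      then obtain x where x: "(z, x) \<in> K" "w = h x" by auto
      have zx: "z \<in> B" "x \<in> \<Gamma>" using x(1) K\<Gamma> by auto
      have "F (z, x) \<in> K" using K(4) x(1) by blast
      then have "?\<pi> (F (z, x)) \<in> ?\<pi> ` K" by blast
      moreover have "h (s (idx z) (\<rho> * h x)) = \<rho> * h x"
        by (rule hs) (use idxN zx h(2) \<rho> in \<open>auto simp: norm_mult\<close>)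
      ultimately show "(f z, \<rho> * w) \<in> ?\<pi> ` K" using x(2) by (simp add: F_def)
    qed
    \<comment> \<open>The rotation inside \<open>F\<close> is undone by taking a point of
      \<open>K\<close> over \<open>w / \<rho>\<close>.\<close>
    have "(f z, s (idx z) w) \<in> F ` K" if zw: "z \<in> B" "w \<in> ?C" for z w
    proof -
      have "(z, w / \<rho>) \<in> ?\<pi> ` K" using \<pi>K zw \<rho> by (simp add: norm_divide)
      then obtain x where x: "(z, x) \<in> K" "h x = w / \<rho>" by auto
      moreover have "\<rho> \<noteq> 0" using \<rho> by auto
      ultimately have "F (z, x) = (f z, s (idx z) w)" by (simp add: F_def)
      then show ?thesis using x(1) by (metis imageI)
    qed
    then show "M \<subseteq> K" using K(4) unfolding M_def by blast
  qed
  have M_ne: "M \<noteq> {}" 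
  proof -
    have "(1::complex) \<in> ?C" by simp
    then show ?thesis using b unfolding M_def by blast
  qed
  have fibre: "circle (M \<inter> ({y} \<times> \<Gamma>))" if y: "y \<in> B" "y \<noteq> b" for y
  proof -
    have "y \<in> f ` B" using surj y(1) by simp
    then obtain z where z: "z \<in> B" "f z = y" by auto
    have eq: "M \<inter> ({y} \<times> \<Gamma>) = (\<lambda>w. (y, s (idx z) w)) ` ?C"

    proof (intro antisym subsetI)
      fix p assume p: "p \<in> M \<inter> ({y} \<times> \<Gamma>)"
      then obtain z' w where z': "z' \<in> B" "w \<in> ?C" "p = (f z', s (idx z') w)" by (auto simp: M_def)
      then have "z' = z" using p z inj y(2) by auto
      then show "p \<in> (\<lambda>w. (y, s (idx z) w)) ` ?C" using z' z by auto
    next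
      fix p assume "p \<in> (\<lambda>w. (y, s (idx z) w)) ` ?C"
      then obtain w where w: "w \<in> ?C" "p = (f z, s (idx z) w)" using z by auto
      then have "p \<in> M" using z(1) unfolding M_def by blast
      then show "p \<in> M \<inter> ({y} \<times> \<Gamma>)" using M_sub w z(2) by auto
    qed
    have "?C homeomorphic (\<lambda>w. (y, s (idx z) w)) ` ?C"
    proof (rule homeomorphic_compact[OF compact_sphere _ refl])
      show "continuous_on ?C (\<lambda>w. (y, s (idx z) w))"
        using s[OF idxN[OF z(1)]] by (intro continuous_intros)
      show "inj_on (\<lambda>w. (y, s (idx z) w)) ?C"
        using hs[OF idxN[OF z(1)]] by (intro inj_onI) (metis mem_sphere_0 prod.inject)
    qed
    then show ?thesis unfolding circle_def eq by (subst homeomorphic_sym)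
  qed
  show ?thesis
  proof (rule that[of B f F M b])
    show "skew_system B f \<Gamma> F M b"
      unfolding skew_system_def
    proof (intro conjI ballI impI)
      show "minimal_map B f"
        unfolding minimal_map_def using cf fB min_f B(2)
        by (auto dest: closedin_closed_trans[OF _ compact_imp_closed])
      show "F ` (B \<times> \<Gamma>) \<subseteq> B \<times> \<Gamma>" using F_im M_sub by blast
      show "minimal_set F M"
        unfolding minimal_set_def
      proof (intro conjI allI impI)
        show clM: "closed M" using M_comp by (rule compact_imp_closed)
        show "F ` M \<subseteq> M" using F_im M_sub by blast
        show "K = M" if "K \<subseteq> M \<and> closedin (top_of_set M) K \<and> K \<noteq> {} \<and> F ` K \<subseteq> K" for K
          using M_min that closedin_closed_trans[OF _ clM] by metis
      qed (rule M_ne)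
    qed (use B \<Gamma> cF M_sub b fibre in \<open>auto simp: F_def\<close>)
    have "M \<inter> ({b} \<times> \<Gamma>) = {b} \<times> (\<Union>k \<in> idx ` {x \<in> B. f x = b}. s k ` ?C)"

    proof (intro antisym subsetI)
      fix p assume "p \<in> {b} \<times> (\<Union>k \<in> idx ` {x \<in> B. f x = b}. s k ` ?C)"
      then obtain x w where x: "x \<in> B" "f x = b" "w \<in> ?C" "p = (f x, s (idx x) w)" by auto
      then have "p \<in> M" unfolding M_def by blast
      then show "p \<in> M \<inter> ({b} \<times> \<Gamma>)" using M_sub x by auto
    qed (auto simp: M_def)
    then show "M \<inter> ({b} \<times> \<Gamma>) = {b} \<times> (\<Union>k<N. s k ` ?C)" by (simp add: idx(3))
  qed
qed

section \<open>Circles in graphs\<close>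

lemma circle_simple_path:
  fixes C :: "'a::metric_space set"
  assumes "circle C" "a \<in> C"
  obtains \<gamma> where "simple_path \<gamma>" "path_image \<gamma> = C" "pathstart \<gamma> = a" "pathfinish \<gamma> = a"
proof -
  obtain f g where fg: "homeomorphism (sphere (0::complex) 1) C f g"
    using assms(1) homeomorphic_sym by (fastforce simp: circle_def homeomorphic_def)
  have ga: "norm (g a) = 1" "f (g a) = a" using fg assms(2) by (auto simp: homeomorphism_def)
  \<comment> \<open>The standard loop, rotated to start at the preimage \<open>g a\<close> of the
    base point.\<close>
  define e where "e t = g a * exp (of_real t * (2 * of_real pi * \<i>))" for t :: real
  have ne: "norm (e t) = 1" for t by (simp add: e_def norm_mult ga)
  have cf: "continuous_on (sphere 0 1) f" "inj_on f (sphere 0 1)" "f ` sphere 0 1 = C"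
    using fg by (auto simp: homeomorphism_def inj_on_def) (metis mem_sphere_0)
  have "path (f \<circ> e)"
    unfolding path_def
    by (intro continuous_on_compose continuous_on_subset[OF cf(1)])
       (auto simp: e_def ne norm_mult ga intro!: continuous_intros)
  moreover have "loop_free (f \<circ> e)"
    unfolding loop_free_def
  proof (intro ballI impI)
    fix x y :: real assume xy: "x \<in> {0..1}" "y \<in> {0..1}" "(f \<circ> e) x = (f \<circ> e) y"
    then have "e x = e y" using cf(2) ne by (auto simp: inj_on_def)
    moreover have "g a \<noteq> 0" using ga by auto
    ultimately have "exp (of_real x * (2 * of_real pi * \<i>)) = exp (of_real y * (2 * of_real pi * \<i>))"
      by (simp add: e_def)
    then obtain n :: int where "of_real x * (2 * of_real pi * \<i>) = of_real y * (2 * of_real pi * \<i>) + (of_int (2 * n) * pi) * \<i>"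
      by (auto simp: exp_eq)
    then have "Im (of_real x * (2 * of_real pi * \<i>)) = Im (of_real y * (2 * of_real pi * \<i>) + (of_int (2 * n) * pi) * \<i>)"
      by (rule arg_cong)
    then have "2 * pi * x = 2 * pi * (y + of_int n)" by (simp add: algebra_simps)
    then have "x = y + of_int n" by simp
    moreover have "of_int n \<le> (1::real)" "-1 \<le> (of_int n::real)" using calculation xy(1,2) by auto
    then have "n = 0 \<or> n = 1 \<or> n = -1" by linarith
    ultimately show "x = y \<or> x = 0 \<and> y = 1 \<or> x = 1 \<and> y = 0" using xy(1,2) by auto
  qed
  ultimately have "simple_path (f \<circ> e)" by (simp add: simple_path_def)
  moreover have "e ` {0..1} = sphere 0 1"
  proof
    show "sphere 0 1 \<subseteq> e ` {0..1}"
    proof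
      fix w :: complex assume "w \<in> sphere 0 1"
      then have "norm (w / g a) = 1" using ga by (simp add: norm_divide)
      then have "w / g a = exp (\<i> * of_real (Arg2pi (w / g a)))" using Arg2pi_eq[of "w / g a"] by simp
      moreover have "g a \<noteq> 0" using ga by auto
      ultimately have "w = e (Arg2pi (w / g a) / (2 * pi))" by (simp add: e_def field_simps)
      moreover have "Arg2pi (w / g a) / (2 * pi) \<in> {0..1}"
        using Arg2pi_ge_0[of "w / g a"] Arg2pi_lt_2pi[of "w / g a"] by (simp add: field_simps)
      ultimately show "w \<in> e ` {0..1}" by blast
    qed
  qed (auto simp: ne)
  then have "path_image (f \<circ> e) = C" using cf(3) by (metis path_image_def image_comp)
  moreover have "pathstart (f \<circ> e) = a" by (simp add: pathstart_def e_def ga)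
  moreover have "pathfinish (f \<circ> e) = a"
    using ga exp_two_pi_i by (simp add: pathfinish_def e_def mult_ac)
  ultimately show ?thesis using that by blast
qed

lemma compact_circle: "circle C \<Longrightarrow> compact C"
  using homeomorphic_compactness[of C "sphere (0::complex) 1"] by (simp add: circle_def)

text \<open>At the last parameter for which the edge is still in the circle, a local parametrisation of
  the circle would be an injective continuous real function with an interior maximum.\<close>

lemma circle_contains_later_edge:
  fixes C :: "'a::metric_space set"
  assumes C: "circle C" "C \<subseteq> G" and g: "arc g"
    and op: "openin (top_of_set G) (g ` {0<..<1})"
    and a: "0 < a" "a \<le> b" "b < 1" "g a \<in> C"
  shows "g b \<in> C"
proof (rule ccontr)
  assume b: "g b \<notin> C"
  have cg: "continuous_on {0..1} g" and ig: "inj_on g {0..1}" using g by (auto simp: arc_def path_def)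
  let ?T = "{t \<in> {a..b}. g t \<in> C}"
  have "closed ({a..b} \<inter> g -` C)"
    by (intro continuous_closed_preimage continuous_on_subset[OF cg] closed_atLeastAtMost
        compact_imp_closed[OF compact_circle[OF C(1)]]) (use a in auto)
  moreover have "{a..b} \<inter> g -` C = ?T" by auto
  ultimately have "closed ?T" by simp
  moreover have "bounded ?T" by (rule bounded_subset[of "{a..b}"]) auto
  ultimately have "compact ?T" by (simp add: compact_eq_bounded_closed)
  moreover have "a \<in> ?T" using a by simp
  ultimately obtain c where c: "c \<in> ?T" "\<forall>t\<in>?T. t \<le> c"
    using compact_attains_sup[of ?T] by blast
  have cb: "c < b" using c(1) b by (cases "c = b") auto
  have gc: "g c \<in> C" using c(1) by simp
  obtain \<gamma> where \<gamma>: "simple_path \<gamma>" "path_image \<gamma> = C" "pathstart \<gamma> = g c" "pathfinish \<gamma> = g c"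
    using circle_simple_path[OF C(1) gc] by blast
  \<comment> \<open>Shifting the loop by half a turn moves \<open>g c\<close> to the interior
    parameter 1/2.\<close>
  define \<delta> where "\<delta> = shiftpath (1/2) \<gamma>"
  have \<delta>: "simple_path \<delta>" "path_image \<delta> = C" "\<delta> (1/2) = g c"
    using simple_path_shiftpath[OF \<gamma>(1)] path_image_shiftpath[of "1/2" \<gamma>] \<gamma>
    by (auto simp: \<delta>_def shiftpath_def pathfinish_def pathstart_def)
  have c\<delta>: "continuous_on {0..1} \<delta>" using \<delta>(1) by (simp add: simple_path_def path_def)
  \<comment> \<open>With the end of the edge beyond \<open>b\<close> removed, a short piece of the
    circle around \<open>g c\<close> consists of points of the edge with parameters below
    \<open>b\<close>.\<close>
  have "openin (top_of_set G) (g ` {0<..<b})"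
  proof -
    have "closed (g ` {b..1})"
      using compact_continuous_image[OF continuous_on_subset[OF cg]] a by (auto intro: compact_imp_closed)
    moreover have "g ` {0<..<b} = g ` {0<..<1} - g ` {b..1}"
      using ig a by (fastforce simp: inj_on_def)
    moreover obtain W where "open W" "g ` {0<..<1} = G \<inter> W" using op by (auto simp: openin_open)
    ultimately show ?thesis by (auto simp: openin_open intro!: exI[of _ "W - g ` {b..1}"])
  qed
  then obtain W where W: "open W" "g ` {0<..<b} = G \<inter> W" by (auto simp: openin_open)
  have "\<delta> (1/2) \<in> W" using W(2) \<delta>(3) c(1) cb a by force
  then obtain d where d: "0 < d" "\<And>t. t \<in> {0..1} \<Longrightarrow> dist t (1/2) < d \<Longrightarrow> \<delta> t \<in> W"
  proof -
    obtain e where e: "0 < e" "\<And>y. dist y (\<delta> (1/2)) < e \<Longrightarrow> y \<in> W"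
      using W(1) \<open>\<delta> (1/2) \<in> W\<close> unfolding open_dist by blast
    moreover have "(1/2::real) \<in> {0..1}" by simp
    ultimately show thesis using c\<delta> that unfolding continuous_on_iff by meson
  qed
  define r where "r = min (d / 2) (1/4)"
  have r: "0 < r" "r < d" "r \<le> 1/4" using d(1) by (auto simp: r_def)
  let ?I = "{1/2 - r..1/2 + r}"
  have I: "?I \<subseteq> {0<..<1}" using r by auto
  have \<delta>I: "\<delta> t \<in> C \<inter> g ` {0<..<b}" if "t \<in> ?I" for t
  proof -
    have "t \<in> {0..1}" "dist t (1/2) < d" using that I r by (auto simp: dist_real_def abs_real_def)
    then have "\<delta> t \<in> W" "\<delta> t \<in> C" using d(2) \<delta>(2) by (auto simp: path_image_def)
    then show ?thesis using W(2) C(2) by auto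
  qed
  obtain k where k: "homeomorphism {0..1} (g ` {0..1}) g k"
    using homeomorphism_compact[OF compact_Icc cg refl ig] by blast
  have kg: "k (g t) = t" if "t \<in> {0..1}" for t using k that by (simp add: homeomorphism_def)
  have "g ` {0<..<b} \<subseteq> g ` {0..1}" using a by (intro image_mono) auto
  then have \<delta>g: "\<delta> ` ?I \<subseteq> g ` {0..1}" using \<delta>I by blast
  have "continuous_on (g ` {0..1}) k" using k by (simp add: homeomorphism_def)
  moreover have "?I \<subseteq> {0..1}" using r by auto
  ultimately have cont: "continuous_on ?I (k \<circ> \<delta>)"
    using \<delta>g by (metis continuous_on_compose continuous_on_subset c\<delta>)
  have inj: "inj_on (k \<circ> \<delta>) ?I"
  proof (rule comp_inj_on)
    show "inj_on \<delta> ?I" using simple_path_inj_on[OF \<delta>(1)] I by (rule inj_on_subset)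
    show "inj_on k (\<delta> ` ?I)"
    proof (rule inj_on_subset)
      show "inj_on k (g ` {0..1})" using kg by (auto simp: inj_on_def)
      show "\<delta> ` ?I \<subseteq> g ` {0..1}" by (rule \<delta>g)
    qed
  qed
  \<comment> \<open>A nearby circle point on the edge has its parameter either below
    \<open>a\<close> or in \<open>?T\<close>, hence at most \<open>c\<close>.\<close>
  have le: "(k \<circ> \<delta>) t \<le> (k \<circ> \<delta>) (1/2)" if tI: "t \<in> ?I" for t
  proof -
    obtain u where u: "u \<in> {0<..<b}" "\<delta> t = g u" using \<delta>I[OF tI] by auto
    have ku: "k (\<delta> t) = u" "k (\<delta> (1/2)) = c" using u \<delta>(3) kg c(1) a by auto
    have "u \<le> c"
    proof (cases "u < a")
      case True
      then show ?thesis using c(1) by simp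
    next
      case False
      then have "u \<in> ?T" using u \<delta>I[OF tI] by auto
      then show ?thesis using c(2) by blast
    qed
    then show ?thesis using ku by simp
  qed
  have "(k \<circ> \<delta>) (1/2 - r) \<le> (k \<circ> \<delta>) (1/2)" "(k \<circ> \<delta>) (1/2 + r) \<le> (k \<circ> \<delta>) (1/2)"
    by (rule le; use r in simp)+
  moreover have "1/2 - r < 1/2" "1/2 < 1/2 + r" using r by auto
  ultimately show False using continuous_inj_imp_mono[OF _ _ cont inj] by (meson not_less)
qed

text \<open>Its complement in the graph is cut out by the end-points of \<open>g\<close> and
  finitely many other edges, which are closed. Edges with the same image as \<open>g\<close> must
  not be removed, as the meeting condition is silent about them.\<close>

lemma edge_interior_open:
  fixes \<G> :: "(real \<Rightarrow> 'a::metric_space) set"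
  assumes fin: "finite \<G>" and arcs: "\<forall>g\<in>\<G>. arc g" and G: "G = \<Union>(path_image ` \<G>)"
    and meet: "\<forall>g\<in>\<G>. \<forall>g'\<in>\<G>. path_image g \<noteq> path_image g' \<longrightarrow>
        path_image g \<inter> path_image g' \<subseteq> {pathstart g, pathfinish g} \<inter> {pathstart g', pathfinish g'}"
    and g: "g \<in> \<G>"
  shows "openin (top_of_set G) (g ` {0<..<1})"
proof -
  let ?\<H> = "{g' \<in> \<G>. path_image g' \<noteq> path_image g}"
  let ?K = "(\<Union>g'\<in>?\<H>. path_image g') \<union> {g 0, g 1}"
  have "closed ?K"
    using fin arcs by (intro closed_Un closed_UN) (auto intro!: closed_path_image arc_imp_path)
  have inj: "inj_on g {0..1}" using arcs g by (simp add: arc_def)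
  have out: "g t \<noteq> g 0" "g t \<noteq> g 1" if "t \<in> {0<..<1}" for t
    using that inj_onD[OF inj, of t 0] inj_onD[OF inj, of t 1] by auto
  have "g ` {0<..<1} = G \<inter> - ?K"
  proof (intro antisym subsetI)
    fix x assume "x \<in> g ` {0<..<1}"
    then obtain t where t: "t \<in> {0<..<1}" "x = g t" by auto
    then have xg: "x \<in> path_image g" by (auto simp: path_image_def)
    have "x \<notin> path_image g'" if "g' \<in> ?\<H>" for g'
      using meet g that xg out[OF t(1)] t(2) by (fastforce simp: pathstart_def pathfinish_def)
    then show "x \<in> G \<inter> - ?K" using xg out[OF t(1)] t(2) g G by auto
  next
    fix x assume x: "x \<in> G \<inter> - ?K"
    then have "x \<in> path_image g" using G by auto
    then obtain t where t: "t \<in> {0..1}" "x = g t" by (auto simp: path_image_def)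
    moreover have "t \<noteq> 0" "t \<noteq> 1" using x t by auto
    ultimately show "x \<in> g ` {0<..<1}" by auto
  qed
  then show ?thesis using openin_open_Int[OF open_Compl[OF \<open>closed ?K\<close>], of G] by (simp only:)
qed

text \<open>The one-sided statement, applied to the edge and to its reverse, covers the open edge;
  the end-points follow because the circle is closed.\<close>

lemma circle_contains_edge:
  fixes C :: "'a::metric_space set"
  assumes C: "circle C" "C \<subseteq> G" and g: "arc g"
    and op: "openin (top_of_set G) (g ` {0<..<1})"
    and t: "t \<in> {0<..<1}" "g t \<in> C"
  shows "path_image g \<subseteq> C"
proof -
  let ?r = "reversepath g"
  have rop: "openin (top_of_set G) (?r ` {0<..<1})"
  proof -
    have "?r ` {0<..<1} = g ` ((\<lambda>x. 1 - x) ` {0<..<1})" by (auto simp: reversepath_def)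
    also have "(\<lambda>x. 1 - x) ` {0<..<1::real} = {0<..<1}"
    proof (intro antisym subsetI)
      show "x \<in> (\<lambda>x. 1 - x) ` {0<..<1}" if "x \<in> {0<..<1}" for x :: real
        using that by (intro image_eqI[of _ _ "1 - x"]) auto
    qed auto
    finally show ?thesis using op by simp
  qed
  have "g u \<in> C" if u: "u \<in> {0<..<1}" for u
  proof (cases "t \<le> u")
    case True
    then show ?thesis using circle_contains_later_edge[OF C g op, of t u] t u by simp
  next
    case False
    then have "?r (1 - u) \<in> C"
      using circle_contains_later_edge[OF C arc_reversepath[OF g] rop, of "1 - t" "1 - u"] t u
      by (simp add: reversepath_def)
    then show ?thesis by (simp add: reversepath_def)
  qed
  then have "g ` {0<..<1} \<subseteq> C" by blast
  moreover have cl: "closure {0<..<1::real} = {0..1}" by simp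
  ultimately have "g ` closure {0<..<1} \<subseteq> C"
    using g compact_imp_closed[OF compact_circle[OF C(1)]]
    by (intro image_closure_subset) (auto simp: arc_def path_def)
  then show ?thesis by (simp add: path_image_def)
qed

lemma circle_islimpt:
  fixes C :: "'a::metric_space set"
  assumes "circle C" "x \<in> C"
  shows "x islimpt C"
proof -
  obtain \<gamma> where \<gamma>: "simple_path \<gamma>" "path_image \<gamma> = C" "pathstart \<gamma> = x" "pathfinish \<gamma> = x"
    using circle_simple_path[OF assms] by blast
  have lf: "loop_free \<gamma>" using \<gamma>(1) by (simp add: simple_path_def)
  have "\<gamma> (1/2) \<noteq> \<gamma> 0" using lf[unfolded loop_free_def, rule_format, of "1/2" 0] by auto
  moreover have "\<gamma> (1/2) \<in> C" using \<gamma>(2) by (force simp: path_image_def)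
  moreover have "connected C" using \<gamma>(1,2) by (metis connected_simple_path_image)
  ultimately show ?thesis
    using assms(2) \<gamma>(3) by (intro connected_imp_perfect) (auto simp: pathstart_def)
qed

text \<open>A point that is not a vertex lies inside an edge, which then belongs to the circle. A
  vertex on the circle is a limit of such points, since there are finitely many vertices and no
  isolated points, and the union of the edges is closed.\<close>

lemma circle_union_of_edges:
  fixes C :: "'a::metric_space set" and \<G> :: "(real \<Rightarrow> 'a) set"
  assumes C: "circle C" "C \<subseteq> \<Union>(path_image ` \<G>)" and fin: "finite \<G>" and arcs: "\<forall>g\<in>\<G>. arc g"
    and op: "\<And>g. g \<in> \<G> \<Longrightarrow> openin (top_of_set (\<Union>(path_image ` \<G>))) (g ` {0<..<1})"
  shows "C = \<Union>(path_image ` {g \<in> \<G>. path_image g \<subseteq> C})"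
proof
  let ?E = "\<Union>(path_image ` {g \<in> \<G>. path_image g \<subseteq> C})"
  let ?V = "\<Union>g\<in>\<G>. {g 0, g 1}"
  have "closed ?E" using fin arcs by (intro closed_Union) (auto intro: closed_path_image arc_imp_path)
  have V: "finite ?V" using fin by simp
  have CE: "C - ?V \<subseteq> ?E"
  proof
    fix x assume x: "x \<in> C - ?V"
    then obtain g t where g: "g \<in> \<G>" "t \<in> {0..1}" "x = g t" using C(2) by (fastforce simp: path_image_def)
    then have "t \<noteq> 0" "t \<noteq> 1" using x by auto
    then have "path_image g \<subseteq> C"
      using circle_contains_edge[OF C _ op[OF g(1)], of t] arcs g x by auto
    then show "x \<in> ?E" using g by (auto simp: path_image_def)
  qed
  show "C \<subseteq> ?E"
  proof
    fix x assume "x \<in> C"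
    then have "x islimpt C" by (rule circle_islimpt[OF C(1)])
    moreover have "C \<subseteq> ?V \<union> (C - ?V)" by blast
    ultimately have "x islimpt (?V \<union> (C - ?V))" using islimpt_subset by blast
    then have "x islimpt (C - ?V)" using islimpt_Un_finite[OF V] by blast
    then have "x islimpt ?E" using CE islimpt_subset by blast
    then show "x \<in> ?E" using \<open>closed ?E\<close> closed_limpt by blast
  qed
qed blast

text \<open>Both circles are unions of edges, so those edges present their union as a graph. The
  second part says that \<open>C1\<close> is open in \<open>G\<close> off the finitely many
  vertices; it later bounds the number of handles.\<close>

lemma is_graph_Un_circles:
  fixes G :: "'a::metric_space set"
  assumes G: "is_graph G" and C: "circle C1" "C1 \<subseteq> G" "circle C2" "C2 \<subseteq> G"
  shows "is_graph (C1 \<union> C2)"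
    and "\<exists>V. finite V \<and> (\<forall>x\<in>C1 - V. \<exists>W. openin (top_of_set G) W \<and> x \<in> W \<and> W \<subseteq> C1)"
proof -
  obtain \<G> :: "(real \<Rightarrow> 'a) set" where \<G>: "finite \<G>" "\<forall>g\<in>\<G>. arc g" "G = \<Union>(path_image ` \<G>)"
    "\<forall>g\<in>\<G>. \<forall>g'\<in>\<G>. path_image g \<noteq> path_image g' \<longrightarrow>
        path_image g \<inter> path_image g' \<subseteq> {pathstart g, pathfinish g} \<inter> {pathstart g', pathfinish g'}"
    using G unfolding is_graph_def by blast
  have op: "openin (top_of_set G) (g ` {0<..<1})" if "g \<in> \<G>" for g
    by (rule edge_interior_open[OF \<G> that])
  let ?\<H> = "{g \<in> \<G>. path_image g \<subseteq> C1} \<union> {g \<in> \<G>. path_image g \<subseteq> C2}"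
  have un: "C = \<Union>(path_image ` {g \<in> \<G>. path_image g \<subseteq> C})" if "circle C" "C \<subseteq> G" for C
    by (rule circle_union_of_edges[OF that(1) _ \<G>(1,2)]) (use that \<G>(3) op in auto)
  have "C1 \<union> C2 = \<Union>(path_image ` ?\<H>)" using un[OF C(1,2)] un[OF C(3,4)] by (simp add: image_Un)
  moreover have "C1 \<noteq> {}" using C(1) by (auto simp: circle_def)
  then have "?\<H> \<noteq> {}" using un[OF C(1,2)] by auto
  moreover have "finite ?\<H>" using \<G>(1) by simp
  moreover have "\<forall>g\<in>?\<H>. arc g" using \<G>(2) by blast
  moreover have "\<forall>g\<in>?\<H>. \<forall>g'\<in>?\<H>. path_image g \<noteq> path_image g' \<longrightarrow>
        path_image g \<inter> path_image g' \<subseteq> {pathstart g, pathfinish g} \<inter> {pathstart g', pathfinish g'}"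
    using \<G>(4) by blast
  ultimately show "is_graph (C1 \<union> C2)" unfolding is_graph_def by blast
  let ?V = "\<Union>g\<in>\<G>. {g 0, g 1}"
  have "\<exists>W. openin (top_of_set G) W \<and> x \<in> W \<and> W \<subseteq> C1" if x: "x \<in> C1 - ?V" for x
  proof -
    obtain g t where g: "g \<in> \<G>" "t \<in> {0..1}" "x = g t" using C(2) \<G>(3) x by (fastforce simp: path_image_def)
    then have t: "t \<in> {0<..<1}" using x by (cases "t = 0"; cases "t = 1") auto
    then have "path_image g \<subseteq> C1"
      using circle_contains_edge[OF C(1,2) _ op[OF g(1)] t] \<G>(2) g x by auto
    moreover have "g ` {0<..<1} \<subseteq> path_image g" by (auto simp: path_image_def)
    ultimately show ?thesis using op[OF g(1)] t g(3) by blast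
  qed
  moreover have "finite ?V" using \<G>(1) by simp
  ultimately show "\<exists>V. finite V \<and> (\<forall>x\<in>C1 - V. \<exists>W. openin (top_of_set G) W \<and> x \<in> W \<and> W \<subseteq> C1)" by blast
qed

section \<open>Transport of graphs by injective continuous maps\<close>

lemma is_graph_injective_image:
  fixes f :: "'a::metric_space \<Rightarrow> 'b::metric_space"
  assumes G: "is_graph G" and f: "continuous_on G f" "inj_on f G"
  shows "is_graph (f ` G)"
proof -
  obtain \<G> :: "(real \<Rightarrow> 'a) set" where \<G>: "finite \<G>" "\<G> \<noteq> {}" "\<forall>g\<in>\<G>. arc g" "G = \<Union>(path_image ` \<G>)"
    "\<forall>g\<in>\<G>. \<forall>g'\<in>\<G>. path_image g \<noteq> path_image g' \<longrightarrow>
        path_image g \<inter> path_image g' \<subseteq> {pathstart g, pathfinish g} \<inter> {pathstart g', pathfinish g'}"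
    using G unfolding is_graph_def by blast
  have sub: "path_image g \<subseteq> G" if "g \<in> \<G>" for g using that \<G>(4) by blast
  have im: "path_image (f \<circ> g) = f ` path_image g" for g :: "real \<Rightarrow> 'a"
    by (simp add: path_image_compose)
  have arcs: "arc (f \<circ> g)" if "g \<in> \<G>" for g
    using \<G>(3) that sub[OF that] f unfolding arc_def path_def path_image_def
    by (metis comp_inj_on continuous_on_compose continuous_on_subset inj_on_subset)
  have meet: "path_image (f \<circ> g) \<inter> path_image (f \<circ> g')
      \<subseteq> {pathstart (f \<circ> g), pathfinish (f \<circ> g)} \<inter> {pathstart (f \<circ> g'), pathfinish (f \<circ> g')}"
    if gg: "g \<in> \<G>" "g' \<in> \<G>" "path_image (f \<circ> g) \<noteq> path_image (f \<circ> g')" for g g'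
  proof -
    have "path_image g \<noteq> path_image g'" using gg(3) im by metis
    then have sm: "path_image g \<inter> path_image g' \<subseteq> {pathstart g, pathfinish g} \<inter> {pathstart g', pathfinish g'}"
      using \<G>(5) gg by blast
    have "path_image (f \<circ> g) \<inter> path_image (f \<circ> g') = f ` (path_image g \<inter> path_image g')"
      unfolding im by (rule inj_on_image_Int[OF f(2) sub sub, symmetric]) (use gg in auto)
    then show ?thesis using sm by (auto simp: pathstart_compose pathfinish_compose)
  qed
  have un: "f ` G = \<Union>(path_image ` ((\<lambda>g. f \<circ> g) ` \<G>))"
    using \<G>(4) by (simp add: im image_UN image_image)
  show ?thesis
    unfolding is_graph_def
  proof (intro exI conjI ballI impI)
    show "finite ((\<lambda>g. f \<circ> g) ` \<G>)" "(\<lambda>g. f \<circ> g) ` \<G> \<noteq> {}" using \<G>(1,2) by auto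
    show "f ` G = \<Union>(path_image ` ((\<lambda>g. f \<circ> g) ` \<G>))" by (rule un)
    show "arc g" if "g \<in> (\<lambda>g. f \<circ> g) ` \<G>" for g using that arcs by auto
    show "path_image g \<inter> path_image g' \<subseteq> {pathstart g, pathfinish g} \<inter> {pathstart g', pathfinish g'}"
      if gg: "g \<in> (\<lambda>g. f \<circ> g) ` \<G>" "g' \<in> (\<lambda>g. f \<circ> g) ` \<G>" "path_image g \<noteq> path_image g'" for g g'
    proof -
      obtain a a' where "a \<in> \<G>" "g = f \<circ> a" "a' \<in> \<G>" "g' = f \<circ> a'" using gg(1,2) by blast
      then show ?thesis using meet[of a a'] gg(3) by simp
    qed
  qed
qed

section \<open>Attaching handles to a circle in space\<close>

definition point3 :: "complex \<Rightarrow> real \<Rightarrow> real^3" where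
  "point3 w t = vector [Re w, Im w, t]"

lemma point3_nth [simp]: "point3 w t $ 1 = Re w" "point3 w t $ 2 = Im w" "point3 w t $ 3 = t"
  by (simp_all add: point3_def)

lemma point3_eq_iff: "point3 w t = point3 w' t' \<longleftrightarrow> w = w' \<and> t = t'"
  by (auto simp: vec_eq_iff forall_3 complex_eq_iff)

lemma continuous_on_point3 [continuous_intros]:
  fixes f :: "'a::t2_space \<Rightarrow> complex"
  assumes "continuous_on S f" "continuous_on S g"
  shows "continuous_on S (\<lambda>x. point3 (f x) (g x))"
  unfolding continuous_on_componentwise[where f = "\<lambda>x. point3 (f x) (g x)"] Basis_vec_def
  using assms by (auto simp: forall_3 inner_axis intro!: continuous_intros)

text \<open>The page with index \<open>k\<close> is the cone of slope \<open>k\<close> through the unit circle; the graph of a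
  nonnegative function over the circle is drawn on it. Distinct pages meet only in the circle.\<close>

definition page :: "(complex \<Rightarrow> real) \<Rightarrow> nat \<Rightarrow> complex \<Rightarrow> real^3" where
  "page d k w = point3 (of_real (1 + d w) * w) (real k * d w)"

text \<open>The angular coordinate around the third axis, with value 0 on the axis: the common left
  inverse of all pages.\<close>

definition direction :: "real^3 \<Rightarrow> complex" where
  "direction x = sgn (Complex (x $ 1) (x $ 2))"

lemma direction_point3: "direction (point3 w t) = sgn w"
  by (simp add: direction_def)

lemma direction_page:
  assumes "0 \<le> d w" "norm w = 1"
  shows "direction (page d k w) = w"
proof -
  have pos: "0 < 1 + d w" using assms by simp
  then have "norm (complex_of_real (1 + d w)) = 1 + d w" by (simp only: norm_of_real abs_of_pos)
  then have "sgn (of_real (1 + d w) * w) = w"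
    using assms(2) pos by (simp add: sgn_eq norm_mult del: of_real_add)
  then show ?thesis by (simp add: page_def direction_point3)
qed

text \<open>The direction recovers the point of the circle, the distance from the axis recovers
  \<open>d\<close>, and the height then recovers the slope, unless \<open>d\<close>
  vanishes.\<close>

lemma page_eqD:
  assumes "page d k w = page d' k' w'" "0 \<le> d w" "0 \<le> d' w'" "norm w = 1" "norm w' = 1"
  shows "w = w'" "d w = d' w'" "k = k' \<or> d w = 0"
proof -
  show w: "w = w'" using assms direction_page by metis
  have "of_real (1 + d w) * w = of_real (1 + d' w') * w'" and k: "real k * d w = real k' * d' w'"
    using assms(1) by (simp_all add: page_def point3_eq_iff)
  moreover have "w \<noteq> 0" using assms(4) by auto
  ultimately have "complex_of_real (1 + d w) = of_real (1 + d' w')" using w by simp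
  then show dd: "d w = d' w'" by (simp only: of_real_eq_iff)
  show "k = k' \<or> d w = 0" using k dd by auto
qed

lemma continuous_on_page:
  assumes "continuous_on UNIV d"
  shows "continuous_on S (page d k)"
  unfolding page_def using continuous_on_subset[OF assms subset_UNIV]
  by (intro continuous_intros) auto

text \<open>Supplies the arc that a handle is to replace, together with a bump supported on it. The
  end-points may coincide, hence injectivity on the open interval.\<close>

lemma arc_on_unit_circle:
  fixes p q :: complex
  assumes "norm p = 1" "norm q = 1"
  obtains e :: "real \<Rightarrow> complex" and d :: "complex \<Rightarrow> real"
  where "continuous_on UNIV e" "\<forall>t. norm (e t) = 1" "e 0 = p" "e 1 = q" "inj_on e {0<..<1}"
    "continuous_on UNIV d" "\<forall>w. 0 \<le> d w" "d p = 0" "d q = 0"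
    "\<forall>w. norm w = 1 \<longrightarrow> (0 < d w \<longleftrightarrow> w \<in> e ` {0<..<1})"
proof -
  obtain \<alpha> L where L: "0 < L" "L \<le> pi" and p: "p = cis \<alpha>" and q: "q = cis (\<alpha> + 2 * L)"
  proof -
    have p: "p = cis (Arg p)" using assms(1) by (metis cis_Arg norm_zero sgn_div_norm zero_neq_one inverse_1 scaleR_one)
    have n: "norm (q / p) = 1" using assms by (simp add: norm_divide)
    then have qp: "q / p = cis (Arg2pi (q / p))" using Arg2pi_eq[of "q / p"] by (simp add: cis_conv_exp)
    have p0: "p \<noteq> 0" using assms(1) by auto
    show thesis
    \<comment> \<open>For equal end-points the arc is the full turn, with half-length
      \<open>pi\<close>.\<close>
    proof (cases "Arg2pi (q / p) = 0")
      case True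
      then have "q = p" using qp p0 by simp
      then show ?thesis using that[of pi "Arg p"] p by (simp add: cis_mult[symmetric])
    next
      case False
      then have "0 < Arg2pi (q / p)" using Arg2pi_ge_0[of "q / p"] by linarith
      moreover have "q = cis (Arg p + Arg2pi (q / p))"
        using qp p p0 by (metis cis_mult nonzero_mult_div_cancel_left times_divide_eq_right mult.commute)
      ultimately show ?thesis
        using that[of "Arg2pi (q / p) / 2" "Arg p"] p Arg2pi_lt_2pi[of "q / p"] by auto
    qed
  qed
  define \<mu> where "\<mu> = \<alpha> + L"
  define e where "e t = cis (\<mu> + L * (2 * t - 1))" for t
  \<comment> \<open>The arc has midpoint \<open>cis \<mu>\<close> and half-length \<open>L\<close>;
    a point of the circle at angle \<open>x\<close> from the midpoint gets
    \<open>cos x - cos L\<close>, cut off at 0, which is positive exactly on the open arc.\<close>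
  define d where "d w = max 0 (Re (w * cis (- \<mu>)) - cos L)" for w
  have d_cis: "d (cis (\<mu> + x)) = max 0 (cos x - cos L)" for x
    by (simp add: d_def cis_mult)
  have eq_cis: "x = y" if "cis (\<mu> + x) = cis (\<mu> + y)" "\<bar>x\<bar> < L" "\<bar>y\<bar> < L" for x y
  proof -
    have "cis (- \<mu>) * cis (\<mu> + x) = cis (- \<mu>) * cis (\<mu> + y)" using that(1) by simp
    then have "cis x = cis y" by (simp add: cis_mult)
    moreover have "Arg (cis x) = x" "Arg (cis y) = y" using that L by (auto intro!: Arg_cis)
    ultimately show ?thesis by metis
  qed
  show ?thesis
  proof (rule that[of e d])
    show "continuous_on UNIV e"
      unfolding e_def cis_conv_exp by (intro continuous_intros)
    show "\<forall>t. norm (e t) = 1" by (simp add: e_def)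
    show "e 0 = p" "e 1 = q" by (simp_all add: e_def p q \<mu>_def algebra_simps)
    show "inj_on e {0<..<1}"
    proof (rule inj_onI)
      fix x y :: real assume xy: "x \<in> {0<..<1}" "y \<in> {0<..<1}" "e x = e y"
      have "\<bar>L * (2 * t - 1)\<bar> < L" if "t \<in> {0<..<1}" for t
        using that L(1) by (simp add: abs_mult) (auto simp: abs_real_def)
      then have "L * (2 * x - 1) = L * (2 * y - 1)" using eq_cis xy unfolding e_def by blast
      then show "x = y" using L(1) by simp
    qed
    show "continuous_on UNIV d" unfolding d_def by (intro continuous_intros)
    show "\<forall>w. 0 \<le> d w" by (simp add: d_def)
    show "d p = 0" using d_cis[of "- L"] by (simp add: p \<mu>_def)
    show "d q = 0" using d_cis[of L] by (simp add: q \<mu>_def algebra_simps)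
    show "\<forall>w. norm w = 1 \<longrightarrow> (0 < d w \<longleftrightarrow> w \<in> e ` {0<..<1})"
    proof (intro allI impI)
      fix w :: complex assume w: "norm w = 1"
      define x where "x = Arg (w * cis (- \<mu>))"
      have "norm (w * cis (- \<mu>)) = 1" using w by (simp add: norm_mult)
      then have "w * cis (- \<mu>) = cis x"
        unfolding x_def by (metis cis_Arg norm_zero sgn_div_norm zero_neq_one inverse_1 scaleR_one)
      then have "w * cis (- \<mu>) * cis \<mu> = cis (\<mu> + x)" by (simp add: cis_mult add.commute)
      then have wx: "w = cis (\<mu> + x)" by (simp add: mult.assoc cis_mult)
      have x: "- pi < x" "x \<le> pi" unfolding x_def using Arg_bounded by blast+
      have "0 < d w \<longleftrightarrow> cos L < cos \<bar>x\<bar>" by (simp add: wx d_cis less_max_iff_disj)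
      also have "\<dots> \<longleftrightarrow> \<bar>x\<bar> < L" using x L by (subst cos_mono_less_eq) auto
      also have "\<dots> \<longleftrightarrow> w \<in> e ` {0<..<1}"
      proof
        assume "\<bar>x\<bar> < L"
        then have "(x / L + 1) / 2 \<in> {0<..<1}" using L(1) by (auto simp: field_simps abs_less_iff)
        moreover have "w = e ((x / L + 1) / 2)" using L(1) by (simp add: wx e_def field_simps)
        ultimately show "w \<in> e ` {0<..<1}" by blast
      next
        assume "w \<in> e ` {0<..<1}"
        then obtain t where t: "t \<in> {0<..<1}" "w = cis (\<mu> + L * (2 * t - 1))" by (auto simp: e_def)
        have lt: "\<bar>L * (2 * t - 1)\<bar> < L" using t(1) L(1) by (simp add: abs_mult) (auto simp: abs_real_def)
        have "cis (- \<mu>) * cis (\<mu> + x) = cis (- \<mu>) * cis (\<mu> + L * (2 * t - 1))" using wx t(2) by simp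
        then have "cis x = cis (L * (2 * t - 1))" by (simp add: cis_mult)
        moreover have "Arg (cis x) = x" "Arg (cis (L * (2 * t - 1))) = L * (2 * t - 1)"
          using x lt L(2) by (auto intro!: Arg_cis)
        ultimately show "\<bar>x\<bar> < L" using lt by metis
      qed
      finally show "0 < d w \<longleftrightarrow> w \<in> e ` {0<..<1}" .
    qed
  qed
qed

text \<open>A continuous map from a compact space to a Hausdorff space is closed, so it is a
  quotient map onto its image.\<close>

lemma continuous_on_compact_image_factor:
  fixes g :: "'a::topological_space \<Rightarrow> 'b::t2_space" and f :: "'b \<Rightarrow> 'c::topological_space"
  assumes S: "compact S" and g: "continuous_on S g" and fg: "continuous_on S (\<lambda>x. f (g x))"
  shows "continuous_on (g ` S) f"
  unfolding continuous_on_closed_invariant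
proof (intro allI impI)
  fix T :: "'c set" assume "closed T"
  then obtain A where A: "closed A" "A \<inter> S = (\<lambda>x. f (g x)) -` T \<inter> S"
    using fg unfolding continuous_on_closed_invariant by blast
  have "compact (S \<inter> A)" using S A(1) by (rule compact_Int_closed)
  then have "compact (g ` (S \<inter> A))" using g by (metis compact_continuous_image continuous_on_subset inf_le1)
  moreover have "g ` (S \<inter> A) = f -` T \<inter> g ` S" using A(2) by blast
  ultimately show "\<exists>A. closed A \<and> A \<inter> g ` S = f -` T \<inter> g ` S"
    by (intro exI[of _ "g ` (S \<inter> A)"]) (auto intro: compact_imp_closed)
qed

text \<open>Handles may share end-points, and one may be a loop; hence \<open>simple_path\<close> in
  place of \<open>arc\<close>.\<close>

definition handles :: "'a::topological_space set \<Rightarrow> (real \<Rightarrow> 'a) set \<Rightarrow> bool" where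
  "handles C \<A> \<longleftrightarrow>
     (\<forall>\<gamma>\<in>\<A>. simple_path \<gamma> \<and> \<gamma> 0 \<in> C \<and> \<gamma> 1 \<in> C \<and> \<gamma> ` {0<..<1} \<inter> C = {}) \<and>
     (\<forall>\<gamma>\<in>\<A>. \<forall>\<gamma>'\<in>\<A>. \<gamma> \<noteq> \<gamma>' \<longrightarrow> \<gamma> ` {0<..<1} \<inter> \<gamma>' ` {0<..<1} = {})"

lemma path_image_interior: "path_image \<gamma> = insert (\<gamma> 0) (insert (\<gamma> 1) (\<gamma> ` {0<..<1}))"
proof -
  have "{0..1} = insert 0 (insert 1 {0<..<1::real})" by auto
  then show ?thesis by (metis path_image_def image_insert)
qed

text \<open>Induction on the handles: each new one is drawn on a new page, over the arc between the
  images of its end-points. Keeping \<open>d 0\<close> equal to zero makes page 0 the unit circle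
  itself.\<close>

lemma embed_circle_with_handles:
  fixes C :: "'a::metric_space set"
  assumes \<eta>: "continuous_on C \<eta>" "inj_on \<eta> C" "\<eta> ` C = sphere (0::complex) 1" and C: "compact C"
    and fin: "finite \<A>" and \<A>: "handles C \<A>"
  shows "\<exists>m d \<Phi>. (\<forall>k. continuous_on UNIV (d k)) \<and> (\<forall>k w. 0 \<le> d k w) \<and> (\<forall>w. d 0 w = 0) \<and>
      continuous_on (C \<union> \<Union>(path_image ` \<A>)) \<Phi> \<and> inj_on \<Phi> (C \<union> \<Union>(path_image ` \<A>)) \<and>
      \<Phi> ` (C \<union> \<Union>(path_image ` \<A>)) = (\<Union>k\<le>m. page (d k) k ` sphere 0 1) \<and>
      (\<forall>x\<in>C. \<Phi> x = point3 (\<eta> x) 0)"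
  using fin \<A>
proof (induction \<A> rule: finite_induct)
  case empty
  have im: "(\<lambda>x. point3 (\<eta> x) 0) ` C = page (\<lambda>_. 0) 0 ` sphere 0 1"
    unfolding \<eta>(3)[symmetric] by (simp add: image_image page_def)
  show ?case
    by (rule exI[of _ 0], rule exI[of _ "\<lambda>_ _. 0"], rule exI[of _ "\<lambda>x. point3 (\<eta> x) 0"])
       (use \<eta>(1,2) im in \<open>auto simp: inj_on_def point3_eq_iff intro!: continuous_intros\<close>)
next
  case (insert \<gamma> \<A>)
  let ?X = "C \<union> \<Union>(path_image ` \<A>)"
  have h: "handles C \<A>" using insert.prems by (auto simp: handles_def)
  obtain m d \<Phi> where d: "\<forall>k. continuous_on UNIV (d k)" "\<forall>k w. 0 \<le> d k w" "\<forall>w. d 0 w = 0"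
    and \<Phi>: "continuous_on ?X \<Phi>" "inj_on \<Phi> ?X" "\<Phi> ` ?X = (\<Union>k\<le>m. page (d k) k ` sphere 0 1)"
      "\<forall>x\<in>C. \<Phi> x = point3 (\<eta> x) 0"
    using insert.IH[OF h] by (elim exE conjE) (rule that; assumption)
  have \<gamma>: "simple_path \<gamma>" "\<gamma> 0 \<in> C" "\<gamma> 1 \<in> C" "\<gamma> ` {0<..<1} \<inter> C = {}"
    using insert.prems by (auto simp: handles_def)
  have path\<gamma>: "path \<gamma>" using \<gamma>(1) by (simp add: simple_path_def)
  have int_X: "\<gamma> ` {0<..<1} \<inter> ?X = {}"
  proof -
    have "\<gamma> ` {0<..<1} \<inter> path_image \<gamma>' = {}" if \<gamma>': "\<gamma>' \<in> \<A>" for \<gamma>'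
    proof -
      have "\<gamma> \<noteq> \<gamma>'" using insert.hyps(2) \<gamma>' by blast
      then have "\<gamma> ` {0<..<1} \<inter> \<gamma>' ` {0<..<1} = {}" using insert.prems \<gamma>' by (simp add: handles_def)
      moreover have "\<gamma>' 0 \<in> C" "\<gamma>' 1 \<in> C" using h \<gamma>' by (auto simp: handles_def)
      then have "\<gamma>' 0 \<notin> \<gamma> ` {0<..<1}" "\<gamma>' 1 \<notin> \<gamma> ` {0<..<1}" using \<gamma>(4) by (metis disjoint_iff)+
      ultimately show ?thesis unfolding path_image_interior[of \<gamma>'] by simp
    qed
    then show ?thesis using \<gamma>(4) by blast
  qed
  have \<eta>1: "norm (\<eta> x) = 1" if "x \<in> C" for x using \<eta>(3) that by (metis imageI mem_sphere_0)
  obtain e :: "real \<Rightarrow> complex" and \<delta> :: "complex \<Rightarrow> real" where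
    e: "continuous_on UNIV e" "\<forall>t. norm (e t) = 1" "e 0 = \<eta> (\<gamma> 0)" "e 1 = \<eta> (\<gamma> 1)" "inj_on e {0<..<1}"
    and \<delta>: "continuous_on UNIV \<delta>" "\<forall>w. 0 \<le> \<delta> w" "\<delta> (\<eta> (\<gamma> 0)) = 0" "\<delta> (\<eta> (\<gamma> 1)) = 0"
    "\<forall>w. norm w = 1 \<longrightarrow> (0 < \<delta> w \<longleftrightarrow> w \<in> e ` {0<..<1})"
    by (rule arc_on_unit_circle[OF \<eta>1[OF \<gamma>(2)] \<eta>1[OF \<gamma>(3)]])
  define \<tau> where "\<tau> = inv_into {0<..<1} \<gamma>"
  have \<tau>: "\<tau> (\<gamma> t) = t" if "t \<in> {0<..<1}" for t
    unfolding \<tau>_def by (rule inv_into_f_f[OF simple_path_inj_on[OF \<gamma>(1)] that])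
  define \<Psi> where "\<Psi> x = (if x \<in> ?X then \<Phi> x else page \<delta> (Suc m) (e (\<tau> x)))" for x
  define d' where "d' = d(Suc m := \<delta>)"
  \<comment> \<open>The formula extends to the end-points because the bump vanishes there. A loop is
    not injective on the closed interval, so continuity is later deduced from this formula through
    the quotient map.\<close>
  have \<Psi>\<gamma>: "\<Psi> (\<gamma> t) = page \<delta> (Suc m) (e t)" if t: "t \<in> {0..1}" for t
  proof -
    consider "t = 0" | "t = 1" | "t \<in> {0<..<1}" using t by fastforce
    then show ?thesis
    proof cases
      case 3
      then have "\<gamma> t \<notin> ?X" using int_X by blast
      then show ?thesis using \<tau>[OF 3] by (simp add: \<Psi>_def)
    qed (use \<gamma> \<Phi>(4) e(3,4) \<delta>(3,4) in \<open>auto simp: \<Psi>_def page_def\<close>)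
  qed
  have compX: "compact ?X"
    using C h insert.hyps(1) by (intro compact_Un compact_Union) (auto simp: handles_def simple_path_def intro!: compact_path_image)
  have Un: "C \<union> \<Union>(path_image ` insert \<gamma> \<A>) = ?X \<union> path_image \<gamma>" by auto
  have Un': "?X \<union> path_image \<gamma> = ?X \<union> \<gamma> ` {0<..<1}"
    unfolding path_image_interior[of \<gamma>] using \<gamma>(2,3) by blast
  have cont: "continuous_on (?X \<union> path_image \<gamma>) \<Psi>"
  proof (rule continuous_on_closed_Un)
    show "closed ?X" using compX by (rule compact_imp_closed)
    show "closed (path_image \<gamma>)" using path\<gamma> by (rule closed_path_image)
    show "continuous_on ?X \<Psi>" using \<Phi>(1) by (rule continuous_on_eq) (simp add: \<Psi>_def)
    have "continuous_on {0..1} (\<lambda>t. page \<delta> (Suc m) (e t))"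
      by (rule continuous_on_compose2[OF continuous_on_page[OF \<delta>(1)] continuous_on_subset[OF e(1)]]) auto
    then have "continuous_on {0..1} (\<lambda>t. \<Psi> (\<gamma> t))" by (rule continuous_on_eq) (simp add: \<Psi>\<gamma>)
    then show "continuous_on (path_image \<gamma>) \<Psi>"
      unfolding path_image_def using path\<gamma>
      by (intro continuous_on_compact_image_factor) (auto simp: path_def)
  qed
  have \<Psi>X: "\<Psi> ` ?X = (\<Union>k\<le>m. page (d k) k ` sphere 0 1)"
    using \<Phi>(3) by (simp add: \<Psi>_def)
  have pos: "0 < \<delta> (e t)" if "t \<in> {0<..<1}" for t using \<delta>(5) e(2) that by blast
  have inj: "inj_on \<Psi> (?X \<union> \<gamma> ` {0<..<1})"
  proof (rule inj_on_Un[THEN iffD2], intro conjI)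
    show "inj_on \<Psi> ?X" using \<Phi>(2) by (simp add: \<Psi>_def inj_on_def)
    show "inj_on \<Psi> (\<gamma> ` {0<..<1})"
    proof (rule inj_onI)
      fix x y assume "x \<in> \<gamma> ` {0<..<1}" "y \<in> \<gamma> ` {0<..<1}" and eq: "\<Psi> x = \<Psi> y"
      then obtain t u where tu: "t \<in> {0<..<1}" "x = \<gamma> t" "u \<in> {0<..<1}" "y = \<gamma> u" by blast
      then have "page \<delta> (Suc m) (e t) = page \<delta> (Suc m) (e u)" using eq \<Psi>\<gamma> by simp
      then have "e t = e u" using page_eqD(1) \<delta>(2) e(2) by blast
      then show "x = y" using e(5) tu by (auto dest: inj_onD)
    qed
    \<comment> \<open>Different pages meet only where the bump vanishes, and it is positive along
      the open handle.\<close>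
    have False if z: "z \<in> \<Psi> ` ?X" "z \<in> \<Psi> ` \<gamma> ` {0<..<1}" for z
    proof -
      obtain k w where k: "k \<le> m" "norm w = 1" "z = page (d k) k w" using z(1) \<Psi>X by auto
      obtain t where t: "t \<in> {0<..<1}" "z = page \<delta> (Suc m) (e t)" using z(2) \<Psi>\<gamma> by auto
      have eq: "page \<delta> (Suc m) (e t) = page (d k) k w" using k t by simp
      have "Suc m = k \<or> \<delta> (e t) = 0" by (rule page_eqD(3)[OF eq]) (use \<delta>(2) d(2) e(2) k(2) in auto)
      then show False using k(1) pos[OF t(1)] by auto
    qed
    then show "\<Psi> ` (?X - \<gamma> ` {0<..<1}) \<inter> \<Psi> ` (\<gamma> ` {0<..<1} - ?X) = {}" by blast
  qed
  have im: "\<Psi> ` (?X \<union> \<gamma> ` {0<..<1}) = (\<Union>k\<le>Suc m. page (d' k) k ` sphere 0 1)"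
  proof -
    have old: "(\<Union>k\<le>m. page (d' k) k ` sphere 0 1) = \<Psi> ` ?X" unfolding \<Psi>X by (simp add: d'_def)
    \<comment> \<open>Off the arc the new page runs along the unit circle, that is, along page
      0.\<close>
    have "page \<delta> (Suc m) ` sphere 0 1 \<subseteq> \<Psi> ` ?X \<union> \<Psi> ` \<gamma> ` {0<..<1}"
    proof
      fix z assume "z \<in> page \<delta> (Suc m) ` sphere 0 1"
      then obtain w where w: "norm w = 1" "z = page \<delta> (Suc m) w" by auto
      show "z \<in> \<Psi> ` ?X \<union> \<Psi> ` \<gamma> ` {0<..<1}"
      proof (cases "0 < \<delta> w")
        case True
        then obtain t where "t \<in> {0<..<1}" "w = e t" using \<delta>(5) w(1) by blast
        then have "z = \<Psi> (\<gamma> t)" "t \<in> {0<..<1}" using \<Psi>\<gamma> w(2) by auto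
        then show ?thesis by blast
      next
        case False
        then have "\<delta> w = 0" using \<delta>(2) by (simp add: order.antisym not_less)
        then have "z = page (d 0) 0 w" using w(2) d(3) by (simp add: page_def)
        then have "z \<in> (\<Union>k\<le>m. page (d k) k ` sphere 0 1)" using w(1) by (intro UN_I[of 0]) auto
        then show ?thesis using \<Psi>X by simp
      qed
    qed
    then have "A \<union> B = P \<union> A" if "A = \<Psi> ` ?X" "B = \<Psi> ` \<gamma> ` {0<..<1}" "P = page \<delta> (Suc m) ` sphere 0 1" "B \<subseteq> P" for A B P
      using that by blast
    moreover have "\<Psi> ` \<gamma> ` {0<..<1} \<subseteq> page \<delta> (Suc m) ` sphere 0 1"
      using \<Psi>\<gamma> e(2) by auto
    moreover have "(\<Union>k\<le>Suc m. page (d' k) k ` sphere 0 1) = page \<delta> (Suc m) ` sphere 0 1 \<union> \<Psi> ` ?X"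
      unfolding atMost_Suc UN_insert old by (simp add: d'_def)
    ultimately show ?thesis by (simp only: image_Un[of \<Psi> ?X "\<gamma> ` {0<..<1}"])
  qed
  show ?case
    unfolding Un Un'
  proof (intro exI[of _ "Suc m"] exI[of _ d'] exI[of _ \<Psi>] conjI)
    show "\<forall>k. continuous_on UNIV (d' k)" "\<forall>k w. 0 \<le> d' k w" "\<forall>w. d' 0 w = 0"
      using d \<delta> by (auto simp: d'_def)
    show "continuous_on (?X \<union> \<gamma> ` {0<..<1}) \<Psi>" using cont unfolding Un' .
    show "\<forall>x\<in>C. \<Psi> x = point3 (\<eta> x) 0" using \<Phi>(4) by (simp add: \<Psi>_def)
  qed (rule inj im)+
qed

section \<open>Cutting the second circle into handles of the first\<close>

lemma circle_handles:
  fixes G :: "'a::metric_space set"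
  assumes G: "is_graph G" and C: "circle C1" "C1 \<subseteq> G" "circle C2" "C2 \<subseteq> G" and a: "a \<in> C1 \<inter> C2"
  obtains \<A> where "finite \<A>" "handles C1 \<A>" "C1 \<union> \<Union>(path_image ` \<A>) = C1 \<union> C2"
proof -
  obtain \<zeta> where \<zeta>: "simple_path \<zeta>" "path_image \<zeta> = C2" "pathstart \<zeta> = a" "pathfinish \<zeta> = a"
    using circle_simple_path[OF C(3)] a by blast
  have cont: "continuous_on {0..1} \<zeta>" using \<zeta>(1) by (simp add: simple_path_def path_def)
  have inj: "t = u \<or> (t = 0 \<and> u = 1) \<or> (t = 1 \<and> u = 0)"
    if "t \<in> {0..1}" "u \<in> {0..1}" "\<zeta> t = \<zeta> u" for t u
    using \<zeta>(1) that unfolding simple_path_def loop_free_def by blast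
  have cl1: "closed C1" using compact_imp_closed[OF compact_circle[OF C(1)]] .
  define Q where "Q = {0..1} \<inter> \<zeta> -` C1"
  have Qcl: "closed Q"
    unfolding Q_def by (rule continuous_closed_preimage[OF cont _ cl1]) simp
  \<comment> \<open>Starting the loop at a common point places 0 and 1 in \<open>Q\<close>, so every
    gap of \<open>Q\<close> has both ends in the unit interval.\<close>
  have Q01: "0 \<in> Q" "1 \<in> Q" using \<zeta>(3,4) a by (auto simp: Q_def pathstart_def pathfinish_def)
  have QC: "\<zeta> t \<in> C1 \<longleftrightarrow> t \<in> Q" if "t \<in> {0..1}" for t using that by (simp add: Q_def)
  \<comment> \<open>The gaps of \<open>Q\<close>, indexed by their left ends.\<close>
  define \<U> where "\<U> = {u \<in> Q. u < 1 \<and> (\<exists>t>u. t \<le> 1 \<and> {u<..t} \<inter> Q = {})}"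
  have "\<exists>v. u < v \<and> v \<in> Q \<and> {u<..<v} \<inter> Q = {}" if u: "u \<in> \<U>" for u
  proof -
    obtain t where t: "u < t" "t \<le> 1" "{u<..t} \<inter> Q = {}" using u by (auto simp: \<U>_def)
    \<comment> \<open>The right end of the gap is the first point of \<open>Q\<close> from
      \<open>t\<close> onwards.\<close>
    have "compact ({t..1} \<inter> Q)" using Qcl by (intro compact_Int_closed) auto
    moreover have "1 \<in> {t..1} \<inter> Q" using t Q01 by auto
    ultimately obtain v where v: "v \<in> {t..1} \<inter> Q" "\<forall>x\<in>{t..1} \<inter> Q. v \<le> x"
      using compact_attains_inf[of "{t..1} \<inter> Q"] by blast
    have "x \<notin> Q" if "x \<in> {u<..<v}" for x
    proof (cases "x \<le> t")
      case True
      then show ?thesis using t(3) that by auto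
    next
      case False
      then have "x \<in> {t..1}" using v(1) that by auto
      then show ?thesis using v(2) that by (metis IntI greaterThanLessThan_iff not_le)
    qed
    then show ?thesis using v(1) t(1) by (intro exI[of _ v]) auto
  qed
  then obtain v where v: "\<forall>u\<in>\<U>. u < v u \<and> v u \<in> Q \<and> {u<..<v u} \<inter> Q = {}" by metis
  have \<U>01: "u \<in> {0..<1}" "v u \<in> {0<..1}" if "u \<in> \<U>" for u
    using that v by (force simp: \<U>_def Q_def)+
  \<comment> \<open>Left ends are sent injectively to vertices: elsewhere \<open>C1\<close> is open
    in the graph, so the loop would stay in \<open>C1\<close> for a while after
    \<open>u\<close>.\<close>
  have "finite \<U>"
  proof -
    obtain V where V: "finite V" "\<forall>x\<in>C1 - V. \<exists>W. openin (top_of_set G) W \<and> x \<in> W \<and> W \<subseteq> C1"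
      using is_graph_Un_circles(2)[OF G C] by blast
    have "\<zeta> u \<in> V" if u: "u \<in> \<U>" for u
    proof (rule ccontr)
      assume "\<zeta> u \<notin> V"
      moreover have "\<zeta> u \<in> C1" using u by (auto simp: \<U>_def Q_def)
      ultimately obtain W where W: "open W" "\<zeta> u \<in> W" "G \<inter> W \<subseteq> C1"
        using V(2) by (metis DiffI IntD2 openin_open)
      obtain e where e: "0 < e" "\<forall>y. dist y (\<zeta> u) < e \<longrightarrow> y \<in> W"
        using W(1,2) unfolding open_dist by blast
      have u01: "u \<in> {0..1}" using \<U>01[OF u] by auto
      then obtain \<delta> where \<delta>: "0 < \<delta>" "\<forall>t\<in>{0..1}. dist t u < \<delta> \<longrightarrow> dist (\<zeta> t) (\<zeta> u) < e"
        using cont e(1) unfolding continuous_on_iff by blast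
      define t where "t = u + min (\<delta> / 2) ((v u - u) / 2)"
      have uv: "u < v u" "{u<..<v u} \<inter> Q = {}" "v u \<le> 1" "0 \<le> u" using v u \<U>01[OF u] by auto
      have t: "u < t" "t < u + \<delta>" "t < v u" using \<delta>(1) uv(1) by (auto simp: t_def min_def field_simps)
      then have t01: "t \<in> {0..1}" using uv by auto
      have "dist t u < \<delta>" using t by (simp add: dist_real_def)
      then have "\<zeta> t \<in> W" using \<delta>(2) e(2) t01 by blast
      moreover have "\<zeta> t \<in> G" using t01 \<zeta>(2) C(4) by (auto simp: path_image_def)
      ultimately have "t \<in> Q" using W(3) QC[OF t01] by blast
      then show False using uv(2) t by auto
    qed
    then have "\<zeta> ` \<U> \<subseteq> V" by blast
    then have "finite (\<zeta> ` \<U>)" using V(1) by (rule finite_subset)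
    moreover have "inj_on \<zeta> \<U>"
    proof (rule inj_onI)
      fix x y assume "x \<in> \<U>" "y \<in> \<U>" "\<zeta> x = \<zeta> y"
      then show "x = y" using inj[of x y] \<U>01(1)[of x] \<U>01(1)[of y] by auto
    qed
    ultimately show ?thesis by (rule finite_imageD)
  qed
  define \<gamma> where "\<gamma> u = \<zeta> \<circ> (\<lambda>x. (v u - u) * x + u)" for u
  have range: "0 \<le> (v u - u) * x" "(v u - u) * x \<le> v u - u" "(v u - u) * x + u \<in> {0..1}"
    if u: "u \<in> \<U>" and x: "x \<in> {0..1}" for u x
  proof -
    have pos: "0 < v u - u" using v u by auto
    show "0 \<le> (v u - u) * x" "(v u - u) * x \<le> v u - u" using x pos by (simp_all add: mult_left_le)
    then show "(v u - u) * x + u \<in> {0..1}" using \<U>01[OF u] by auto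
  qed
  have simple: "simple_path (\<gamma> u)" if u: "u \<in> \<U>" for u
    unfolding simple_path_def
  proof
    have pos: "0 < v u - u" using v u by auto
    have "continuous_on {0..1} (\<lambda>x. \<zeta> ((v u - u) * x + u))"
      by (rule continuous_on_compose2[OF cont]) (use range(3)[OF u] in \<open>auto intro!: continuous_intros\<close>)
    then show "path (\<gamma> u)" by (simp add: path_def \<gamma>_def comp_def)
    \<comment> \<open>Both end parameters of \<open>\<zeta>\<close> are reached only when the gap is
      the whole interval, and then the handle is a loop closing at its own ends.\<close>
    have ends: "x = 0 \<and> y = 1"
      if xy: "x \<in> {0..1}" "y \<in> {0..1}" "(v u - u) * x + u = 0" "(v u - u) * y + u = 1" for x y
    proof -
      have u01: "0 \<le> u" "v u \<le> 1" using \<U>01[OF u] by auto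
      have "(v u - u) * x = 0" using range(1)[OF u xy(1)] xy(3) u01 by linarith
      moreover have "(v u - u) * y = v u - u" using range(2)[OF u xy(2)] xy(4) u01 by linarith
      ultimately show ?thesis using pos by simp
    qed
    show "loop_free (\<gamma> u)"
      unfolding loop_free_def
    proof (intro ballI impI)
      fix x y :: real assume xy: "x \<in> {0..1}" "y \<in> {0..1}" "\<gamma> u x = \<gamma> u y"
      then consider "(v u - u) * x + u = (v u - u) * y + u"
        | "(v u - u) * x + u = 0" "(v u - u) * y + u = 1" | "(v u - u) * y + u = 0" "(v u - u) * x + u = 1"
        using inj[OF range(3)[OF u xy(1)] range(3)[OF u xy(2)]] by (auto simp: \<gamma>_def)
      then show "x = y \<or> x = 0 \<and> y = 1 \<or> x = 1 \<and> y = 0"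
      proof cases
        case 1
        then show ?thesis using pos by simp
      next
        case 2
        then show ?thesis using ends[OF xy(1,2)] by blast
      next
        case 3
        then show ?thesis using ends[OF xy(2,1)] by blast
      qed
    qed
  qed
  have interior: "\<gamma> u ` {0<..<1} = \<zeta> ` {u<..<v u}" if u: "u \<in> \<U>" for u
  proof -
    have pos: "0 < v u - u" using v u by auto
    have "(\<lambda>x. (v u - u) * x + u) ` {0<..<1} = {u<..<v u}"
    proof (intro antisym subsetI)
      fix y assume y: "y \<in> {u<..<v u}"
      have "y = (v u - u) * ((y - u) / (v u - u)) + u" using pos by simp
      moreover have "(y - u) / (v u - u) \<in> {0<..<1}" using y pos by (simp add: field_simps)
      ultimately show "y \<in> (\<lambda>x. (v u - u) * x + u) ` {0<..<1}" by blast
    next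
      fix y assume "y \<in> (\<lambda>x. (v u - u) * x + u) ` {0<..<1}"
      then obtain x where x: "0 < x" "x < 1" "y = (v u - u) * x + u" by auto
      have "0 < (v u - u) * x" "(v u - u) * x < (v u - u) * 1" using pos x by (simp_all only: mult_pos_pos mult_strict_left_mono)
      then show "y \<in> {u<..<v u}" using x(3) by simp
    qed
    then show ?thesis by (simp only: \<gamma>_def image_comp[symmetric])
  qed
  have ends: "\<gamma> u 0 = \<zeta> u" "\<gamma> u 1 = \<zeta> (v u)" for u by (simp_all add: \<gamma>_def)
  have disj: "\<zeta> ` {u<..<v u} \<inter> \<zeta> ` {u'<..<v u'} = {}" if "u \<in> \<U>" "u' \<in> \<U>" "u < u'" for u u'
  proof -
    have "u' \<in> Q" using that by (simp add: \<U>_def)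
    then have "v u \<le> u'" using v that by (metis disjoint_iff greaterThanLessThan_iff not_le)
    then have "\<zeta> s \<noteq> \<zeta> t" if st: "s \<in> {u<..<v u}" "t \<in> {u'<..<v u'}" for s t
    proof -
      have "s < t" "0 < s" "t < 1" using st \<open>v u \<le> u'\<close> \<U>01[OF \<open>u \<in> \<U>\<close>] \<U>01[OF \<open>u' \<in> \<U>\<close>] by auto
      then show ?thesis using inj[of s t] by auto
    qed
    then show ?thesis by blast
  qed
  show ?thesis
  proof (rule that[of "\<gamma> ` \<U>"])
    show "finite (\<gamma> ` \<U>)" using \<open>finite \<U>\<close> by simp
    show "handles C1 (\<gamma> ` \<U>)"
      unfolding handles_def
    proof (intro conjI ballI impI)
      fix g assume "g \<in> \<gamma> ` \<U>"
      then obtain u where u: "u \<in> \<U>" "g = \<gamma> u" by blast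
      then show "simple_path g" using simple by blast
      have "u \<in> Q" "v u \<in> Q" using u v by (auto simp: \<U>_def)
      then show "g 0 \<in> C1" "g 1 \<in> C1" unfolding u(2) ends by (auto simp: Q_def)
      have "\<zeta> t \<notin> C1" if t: "t \<in> {u<..<v u}" for t
      proof -
        have "t \<in> {0..1}" using t \<U>01[OF u(1)] by auto
        moreover have "t \<notin> Q" using v u t by blast
        ultimately show ?thesis using QC by blast
      qed
      then show "g ` {0<..<1} \<inter> C1 = {}" unfolding u(2) interior[OF u(1)] by blast
      fix g' assume "g' \<in> \<gamma> ` \<U>" "g \<noteq> g'"
      then obtain u' where u': "u' \<in> \<U>" "g' = \<gamma> u'" by blast
      have "u < u' \<or> u' < u" using u(2) u'(2) \<open>g \<noteq> g'\<close> by (metis linorder_neqE)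
      then show "g ` {0<..<1} \<inter> g' ` {0<..<1} = {}"
        unfolding u(2) u'(2) interior[OF u(1)] interior[OF u'(1)]
        using disj[OF u(1) u'(1)] disj[OF u'(1) u(1)] by (metis Int_commute)
    qed
    show "C1 \<union> \<Union>(path_image ` (\<gamma> ` \<U>)) = C1 \<union> C2"
    proof (intro antisym Un_least)
      have "path_image (\<gamma> u) \<subseteq> C2" if "u \<in> \<U>" for u
        using range(3)[OF that] unfolding path_image_def \<zeta>(2)[symmetric] by (auto simp: \<gamma>_def)
      then show "\<Union>(path_image ` (\<gamma> ` \<U>)) \<subseteq> C1 \<union> C2" by blast
      show "C2 \<subseteq> C1 \<union> \<Union>(path_image ` (\<gamma> ` \<U>))"
      proof
        fix x assume "x \<in> C2"
        then obtain t where t: "t \<in> {0..1}" "x = \<zeta> t" using \<zeta>(2) by (auto simp: path_image_def)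
        show "x \<in> C1 \<union> \<Union>(path_image ` (\<gamma> ` \<U>))"
        proof (cases "t \<in> Q")
          case True
          then show ?thesis using QC[OF t(1)] t(2) by blast
        next
          case False
          \<comment> \<open>The gap around \<open>t\<close> starts at the last point of
            \<open>Q\<close> before \<open>t\<close>.\<close>
          have "compact ({0..t} \<inter> Q)" using Qcl by (intro compact_Int_closed) auto
          moreover have "0 \<in> {0..t} \<inter> Q" using t Q01 by auto
          ultimately obtain u where u: "u \<in> {0..t} \<inter> Q" "\<forall>x\<in>{0..t} \<inter> Q. x \<le> u"
            using compact_attains_sup[of "{0..t} \<inter> Q"] by blast
          have ut: "u < t" using u(1) False by (cases "u = t") auto
          have gap: "{u<..t} \<inter> Q = {}"
          proof (rule ccontr)
            assume "{u<..t} \<inter> Q \<noteq> {}"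
            then obtain y where y: "u < y" "y \<le> t" "y \<in> Q" by auto
            moreover have "0 \<le> u" using u(1) by auto
            ultimately have "y \<in> {0..t} \<inter> Q" by auto
            then have "y \<le> u" by (rule bspec[OF u(2)])
            then show False using y(1) by simp
          qed
          then have uU: "u \<in> \<U>" using u(1) ut t(1) by (auto simp: \<U>_def)
          have "t < v u" using v uU gap ut
            by (metis disjoint_iff greaterThanAtMost_iff not_le)
          then have "x \<in> \<gamma> u ` {0<..<1}" using interior[OF uU] ut t(2) by auto
          then show ?thesis using uU unfolding path_image_interior[of "\<gamma> u"] by (auto simp: path_image_interior)
        qed
      qed
    qed auto
  qed
qed

section \<open>Realising two circles\<close>

lemma continuous_on_direction:
  assumes "\<And>x. x \<in> S \<Longrightarrow> direction x \<noteq> 0"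
  shows "continuous_on S direction"
proof -
  have "continuous_on S (\<lambda>x::real^3. Complex (x $ 1) (x $ 2))"
    by (intro continuous_on_Complex continuous_intros)
  then show ?thesis
    unfolding direction_def by (rule continuous_on_sgn) (use assms in \<open>auto simp: direction_def sgn_zero_iff\<close>)
qed

text \<open>Here \<open>direction\<close> is the map onto the circle that the sections split.
  Injectivity is passed on so that distinct or disjoint circles have distinct or disjoint images in
  the fibre.\<close>

lemma skew_system_from_embedding:
  fixes \<Gamma> :: "(real^3) set" and \<Phi> :: "'a::metric_space \<Rightarrow> real^3"
    and N :: nat and s :: "nat \<Rightarrow> complex \<Rightarrow> real^3"
  assumes \<Gamma>: "is_graph \<Gamma>" "connected \<Gamma>" "\<And>x. x \<in> \<Gamma> \<Longrightarrow> norm (direction x) = 1" and N: "0 < N"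
    and s: "\<And>k. k < N \<Longrightarrow> continuous_on (sphere 0 1) (s k)"
      "\<And>k w. k < N \<Longrightarrow> norm w = 1 \<Longrightarrow> s k w \<in> \<Gamma>"
      "\<And>k w. k < N \<Longrightarrow> norm w = 1 \<Longrightarrow> direction (s k w) = w"
    and C: "circle C1" "circle C2"
    and \<Phi>: "continuous_on (C1 \<union> C2) \<Phi>" "inj_on \<Phi> (C1 \<union> C2)"
      "\<Phi> ` (C1 \<union> C2) = (\<Union>k<N. s k ` sphere 0 1)"
  shows "\<exists>B f F M b. skew_system B f \<Gamma> F M b \<and>
      circle ((\<lambda>x. (b, \<Phi> x)) ` C1) \<and> circle ((\<lambda>x. (b, \<Phi> x)) ` C2) \<and>
      M \<inter> ({b} \<times> \<Gamma>) = (\<lambda>x. (b, \<Phi> x)) ` C1 \<union> (\<lambda>x. (b, \<Phi> x)) ` C2 \<and>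
      (M \<inter> ({b} \<times> \<Gamma>)) homeomorphic (C1 \<union> C2) \<and>
      inj_on (\<lambda>x. (b, \<Phi> x)) (C1 \<union> C2)"
proof -
  have cd: "continuous_on \<Gamma> direction"
    by (rule continuous_on_direction) (use \<Gamma>(3) in force)
  obtain B f F M b where sys: "skew_system B f \<Gamma> F M b"
    and Mb: "M \<inter> ({b} \<times> \<Gamma>) = {b} \<times> (\<Union>k<N. s k ` sphere 0 1)"
  proof (rule skew_system_from_sections[OF \<Gamma>(1,2) N cd, of s])
    show "norm (direction x) = 1" if "x \<in> \<Gamma>" for x using \<Gamma>(3) that .
    show "continuous_on (sphere 0 1) (s k)" if "k < N" for k using s(1) that .
    show "s k w \<in> \<Gamma>" "direction (s k w) = w" if "k < N" "norm w = 1" for k w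
      using s(2,3) that by blast+
  qed
  let ?\<phi> = "\<lambda>x. (b, \<Phi> x)"
  have c: "continuous_on (C1 \<union> C2) ?\<phi>" using \<Phi>(1) by (intro continuous_intros)
  have i: "inj_on ?\<phi> (C1 \<union> C2)" using \<Phi>(2) by (simp add: inj_on_def)
  have M_im: "M \<inter> ({b} \<times> \<Gamma>) = ?\<phi> ` (C1 \<union> C2)" unfolding Mb \<Phi>(3)[symmetric] by blast
  have hom: "?\<phi> ` X homeomorphic X" if X: "X \<subseteq> C1 \<union> C2" "compact X" for X
    using homeomorphic_compact[OF X(2) continuous_on_subset[OF c X(1)] refl inj_on_subset[OF i X(1)]]
    by (subst homeomorphic_sym)
  have "circle (?\<phi> ` X)" if X: "X \<subseteq> C1 \<union> C2" "circle X" for X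
    using homeomorphic_trans[OF hom[OF X(1) compact_circle[OF X(2)]] X(2)[unfolded circle_def]]
    by (simp add: circle_def)
  then have "circle (?\<phi> ` C1)" "circle (?\<phi> ` C2)" using C by auto
  moreover have "?\<phi> ` (C1 \<union> C2) homeomorphic (C1 \<union> C2)"
    using compact_circle C by (intro hom compact_Un) auto
  ultimately show ?thesis using sys i unfolding M_im[symmetric]
    by (metis M_im image_Un)
qed

lemma circle_embedding:
  assumes "circle C"
  obtains \<eta> where "continuous_on C \<eta>" "inj_on \<eta> C" "\<eta> ` C = sphere (0::complex) 1"
proof -
  obtain \<eta> g where "homeomorphism C (sphere (0::complex) 1) \<eta> g"
    using assms by (auto simp: circle_def homeomorphic_def)
  then have "continuous_on C \<eta>" "\<eta> ` C = sphere 0 1" "\<forall>x\<in>C. g (\<eta> x) = x" by (auto simp: homeomorphism_def)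
  then show ?thesis using that by (metis inj_on_inverseI)
qed

section \<open>The dumbbell: two parallel circles joined by a segment\<close>

definition half_circle :: "real \<Rightarrow> real \<Rightarrow> real \<Rightarrow> real^3" where
  "half_circle \<sigma> c t = point3 (cis (\<sigma> * pi * t)) c"

text \<open>Cosine maps [0, pi] bijectively onto [-1, 1], and \<open>\<sigma>\<close> only chooses
  the sign of the sine; so both halves are arcs from 1 to -1.\<close>

lemma half_circle:
  assumes \<sigma>: "\<sigma> = 1 \<or> \<sigma> = -1"
  shows "arc (half_circle \<sigma> c)"
    "path_image (half_circle \<sigma> c) = {point3 w c | w. norm w = 1 \<and> 0 \<le> \<sigma> * Im w}"
    "pathstart (half_circle \<sigma> c) = point3 1 c" "pathfinish (half_circle \<sigma> c) = point3 (-1) c"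
proof -
  have "continuous_on {0..1} (half_circle \<sigma> c)"
    unfolding half_circle_def cis_conv_exp by (intro continuous_intros)
  moreover have "inj_on (half_circle \<sigma> c) {0..1}"
  proof (rule inj_onI)
    fix x y :: real assume xy: "x \<in> {0..1}" "y \<in> {0..1}" "half_circle \<sigma> c x = half_circle \<sigma> c y"
    then have "cis (\<sigma> * pi * x) = cis (\<sigma> * pi * y)" by (simp add: half_circle_def point3_eq_iff)
    then have "Re (cis (\<sigma> * pi * x)) = Re (cis (\<sigma> * pi * y))" by simp
    then have eq: "cos (pi * x) = cos (pi * y)" using \<sigma> by auto
    have bd: "0 \<le> pi * t \<and> pi * t \<le> pi" if "t \<in> {0..1}" for t
      using that by (simp add: mult_left_le)
    have "pi * x = pi * y" using bd[OF xy(1)] bd[OF xy(2)] eq cos_inj_pi by blast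
    then show "x = y" by simp
  qed
  ultimately show "arc (half_circle \<sigma> c)" by (simp add: arc_def path_def)
  show "pathstart (half_circle \<sigma> c) = point3 1 c" "pathfinish (half_circle \<sigma> c) = point3 (-1) c"
    using \<sigma> by (auto simp: pathstart_def pathfinish_def half_circle_def point3_eq_iff complex_eq_iff)
  show "path_image (half_circle \<sigma> c) = {point3 w c | w. norm w = 1 \<and> 0 \<le> \<sigma> * Im w}"
  proof (intro antisym subsetI)
    fix z assume "z \<in> path_image (half_circle \<sigma> c)"
    then obtain t where t: "0 \<le> t" "t \<le> 1" "z = point3 (cis (\<sigma> * pi * t)) c"
      by (auto simp: path_image_def half_circle_def)
    have "0 \<le> sin (pi * t)" using t by (intro sin_ge_zero) (simp_all add: mult_left_le)
    then have "0 \<le> \<sigma> * Im (cis (\<sigma> * pi * t))" using \<sigma> by auto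
    then show "z \<in> {point3 w c | w. norm w = 1 \<and> 0 \<le> \<sigma> * Im w}" using t(3) by auto
  next
    fix z assume "z \<in> {point3 w c | w. norm w = 1 \<and> 0 \<le> \<sigma> * Im w}"
    then obtain w where w: "z = point3 w c" "norm w = 1" "0 \<le> \<sigma> * Im w" by blast
    define t where "t = arccos (Re w) / pi"
    have re: "-1 \<le> Re w" "Re w \<le> 1" using abs_Re_le_cmod[of w] w(2) by auto
    have t: "0 \<le> t" "t \<le> 1" unfolding t_def using arccos_lbound[OF re] arccos_ubound[OF re] by auto
    have pt: "pi * t = arccos (Re w)" by (simp add: t_def)
    have sq: "(Re w)\<^sup>2 + (Im w)\<^sup>2 = 1" using w(2) by (metis cmod_power2 power_one)
    have "sin (pi * t) = sqrt (1 - (Re w)\<^sup>2)" unfolding pt using re by (simp add: sin_arccos_abs)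
    also have "1 - (Re w)\<^sup>2 = (\<sigma> * Im w)\<^sup>2" using sq \<sigma> by (auto simp: power_mult_distrib)
    finally have "sin (pi * t) = \<sigma> * Im w" using w(3) by simp
    moreover have "cos (pi * t) = Re w" unfolding pt using re by simp
    ultimately have "w = cis (\<sigma> * pi * t)" using \<sigma> by (auto simp: complex_eq_iff)
    then show "z \<in> path_image (half_circle \<sigma> c)"
      using t w(1) by (auto simp: path_image_def half_circle_def)
  qed
qed

definition dumbbell :: "(real^3) set" where
  "dumbbell = (\<lambda>w. point3 w 0) ` sphere 0 1 \<union> (\<lambda>w. point3 w 1) ` sphere 0 1 \<union> point3 1 ` {0..1}"

lemma is_graph_dumbbell: "is_graph dumbbell"
proof -
  let ?\<G> = "{half_circle 1 0, half_circle (-1) 0, half_circle 1 1, half_circle (-1) 1, point3 1}"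
  have seg: "arc (point3 1)" "path_image (point3 1) = point3 1 ` {0..1}"
    "pathstart (point3 1) = point3 1 0" "pathfinish (point3 1) = point3 1 1"
    by (auto simp: arc_def path_def path_image_def pathstart_def pathfinish_def inj_on_def point3_eq_iff
        intro!: continuous_intros)
  note H = half_circle[of 1] half_circle[of "-1"]
  \<comment> \<open>The two halves of one circle meet only in their common end-points.\<close>
  have pm: "w = 1 \<or> w = -1" if "norm w = 1" "0 \<le> Im w" "Im w \<le> 0" for w :: complex
  proof -
    have "Im w = 0" using that by simp
    then have "\<bar>Re w\<bar> = 1" using that(1) by (simp add: cmod_def)
    then show ?thesis using \<open>Im w = 0\<close> by (auto simp: complex_eq_iff abs_if split: if_splits)
  qed
  show ?thesis
    unfolding is_graph_def
  proof (intro exI[of _ ?\<G>] conjI)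
    show "\<forall>g\<in>?\<G>. arc g" using H(1) H(5) seg(1) by simp
    show "dumbbell = \<Union>(path_image ` ?\<G>)"
      using seg(2) H(2) H(6) by (auto simp: dumbbell_def) (metis linear)+
    show "\<forall>g\<in>?\<G>. \<forall>g'\<in>?\<G>. path_image g \<noteq> path_image g' \<longrightarrow>
        path_image g \<inter> path_image g' \<subseteq> {pathstart g, pathfinish g} \<inter> {pathstart g', pathfinish g'}"
      using seg H by (auto simp: point3_eq_iff dest: pm)
  qed auto
qed

lemma connected_dumbbell: "connected dumbbell"
proof -
  have c: "connected ((\<lambda>w. point3 w c) ` sphere 0 1)" for c
    by (intro connected_continuous_image continuous_intros connected_sphere) simp
  have s: "connected (point3 1 ` {0..1})"
    by (intro connected_continuous_image continuous_intros) simp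
  have "point3 1 c \<in> (\<lambda>w. point3 w c) ` sphere 0 1" for c by (rule image_eqI[of _ _ 1]) auto
  moreover have "point3 1 0 \<in> point3 1 ` {0..1}" "point3 1 1 \<in> point3 1 ` {0..1}" by auto
  ultimately have "connected ((\<lambda>w. point3 w 0) ` sphere 0 1 \<union> point3 1 ` {0..1} \<union> (\<lambda>w. point3 w 1) ` sphere 0 1)"
    by (intro connected_Un c s) blast+
  then show ?thesis unfolding dumbbell_def by (simp add: Un_ac)
qed

text \<open>The sections are the parallel circles at heights 0 and 1. The segment joining them lies
  over the point 1, so \<open>direction\<close> has norm 1 there; it makes the graph connected and
  adds nothing to the fibre over \<open>b\<close>.\<close>

lemma skew_system_disjoint_circles:
  fixes C1 C2 :: "'a::metric_space set"
  assumes C: "circle C1" "circle C2" "C1 \<inter> C2 = {}"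
  obtains \<Phi> :: "'a \<Rightarrow> real^3" where "\<exists>B f F M b. skew_system B f dumbbell F M b \<and>
      circle ((\<lambda>x. (b, \<Phi> x)) ` C1) \<and> circle ((\<lambda>x. (b, \<Phi> x)) ` C2) \<and>
      M \<inter> ({b} \<times> dumbbell) = (\<lambda>x. (b, \<Phi> x)) ` C1 \<union> (\<lambda>x. (b, \<Phi> x)) ` C2 \<and>
      (M \<inter> ({b} \<times> dumbbell)) homeomorphic (C1 \<union> C2) \<and>
      inj_on (\<lambda>x. (b, \<Phi> x)) (C1 \<union> C2)"
proof -
  obtain \<eta>1 where \<eta>1: "continuous_on C1 \<eta>1" "inj_on \<eta>1 C1" "\<eta>1 ` C1 = sphere (0::complex) 1"
    by (rule circle_embedding[OF C(1)])
  obtain \<eta>2 where \<eta>2: "continuous_on C2 \<eta>2" "inj_on \<eta>2 C2" "\<eta>2 ` C2 = sphere (0::complex) 1"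
    by (rule circle_embedding[OF C(2)])
  define \<Phi> where "\<Phi> x = (if x \<in> C1 then point3 (\<eta>1 x) 0 else point3 (\<eta>2 x) 1)" for x
  have not1: "x \<notin> C1" if "x \<in> C2" for x using C(3) that by blast
  have cont: "continuous_on (C1 \<union> C2) \<Phi>"
  proof (rule continuous_on_closed_Un)
    show "closed C1" "closed C2" using compact_circle C compact_imp_closed by blast+
    have "continuous_on C1 (\<lambda>x. point3 (\<eta>1 x) 0)" "continuous_on C2 (\<lambda>x. point3 (\<eta>2 x) 1)"
      using \<eta>1(1) \<eta>2(1) by (auto intro!: continuous_intros)
    then show "continuous_on C1 \<Phi>" "continuous_on C2 \<Phi>"
      by (auto simp: \<Phi>_def not1 cong: continuous_on_cong)
  qed
  have inj: "inj_on \<Phi> (C1 \<union> C2)"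
    using \<eta>1(2) \<eta>2(2) not1 by (auto simp: inj_on_def \<Phi>_def point3_eq_iff)
  have "\<Phi> ` C1 = (\<lambda>w. point3 w 0) ` sphere 0 1"
    unfolding \<eta>1(3)[symmetric] image_image by (rule image_cong) (simp_all add: \<Phi>_def)
  moreover have "\<Phi> ` C2 = (\<lambda>w. point3 w 1) ` sphere 0 1"
    unfolding \<eta>2(3)[symmetric] image_image by (rule image_cong) (simp_all add: \<Phi>_def not1)
  moreover have "{..<2::nat} = {0, 1}" by auto
  ultimately have im: "\<Phi> ` (C1 \<union> C2) = (\<Union>k<2. (\<lambda>w. point3 w (real k)) ` sphere 0 1)"
    by (simp add: image_Un)
  show ?thesis
  proof (rule that[of \<Phi>], rule skew_system_from_embedding[where s = "\<lambda>k w. point3 w (real k)" and N = 2])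
    show "norm (direction x) = 1" if "x \<in> dumbbell" for x
      using that by (auto simp: dumbbell_def direction_point3 norm_sgn)
    show "continuous_on (sphere 0 1) (\<lambda>w. point3 w (real k))" for k by (intro continuous_intros)
    show "point3 w (real k) \<in> dumbbell" if "k < 2" "norm w = 1" for k w
      using that by (auto simp: dumbbell_def less_2_cases_iff)
    show "direction (point3 w (real k)) = w" if "norm w = 1" for k w
      using that by (simp add: direction_point3 sgn_eq)
  qed (use is_graph_dumbbell connected_dumbbell C cont inj im in auto)
qed

text \<open>The graph is the embedded union of the circles itself, connected because they meet; the
  pages are the sections.\<close>

lemma skew_system_intersecting_circles:
  fixes G C1 C2 :: "'a::metric_space set"
  assumes G: "is_graph G" and C: "circle C1" "C1 \<subseteq> G" "circle C2" "C2 \<subseteq> G" and ne: "C1 \<inter> C2 \<noteq> {}"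
  obtains \<Gamma> and \<Phi> :: "'a \<Rightarrow> real^3" where "\<exists>B f F M b. skew_system B f \<Gamma> F M b \<and>
      circle ((\<lambda>x. (b, \<Phi> x)) ` C1) \<and> circle ((\<lambda>x. (b, \<Phi> x)) ` C2) \<and>
      M \<inter> ({b} \<times> \<Gamma>) = (\<lambda>x. (b, \<Phi> x)) ` C1 \<union> (\<lambda>x. (b, \<Phi> x)) ` C2 \<and>
      (M \<inter> ({b} \<times> \<Gamma>)) homeomorphic (C1 \<union> C2) \<and>
      inj_on (\<lambda>x. (b, \<Phi> x)) (C1 \<union> C2)"
proof -
  obtain a where a: "a \<in> C1 \<inter> C2" using ne by blast
  obtain \<A> where \<A>: "finite \<A>" "handles C1 \<A>" "C1 \<union> \<Union>(path_image ` \<A>) = C1 \<union> C2"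
    by (rule circle_handles[OF G C a])
  obtain \<eta> where \<eta>: "continuous_on C1 \<eta>" "inj_on \<eta> C1" "\<eta> ` C1 = sphere (0::complex) 1"
    by (rule circle_embedding[OF C(1)])
  obtain m d \<Phi> where d: "\<forall>k. continuous_on UNIV (d k)" "\<forall>k w. 0 \<le> d k w"
    and \<Phi>: "continuous_on (C1 \<union> C2) \<Phi>" "inj_on \<Phi> (C1 \<union> C2)"
      "\<Phi> ` (C1 \<union> C2) = (\<Union>k\<le>m. page (d k) k ` sphere 0 1)"
    using embed_circle_with_handles[OF \<eta> compact_circle[OF C(1)] \<A>(1,2)] unfolding \<A>(3)
    by (elim exE conjE) (rule that; assumption)
  define \<Gamma> where "\<Gamma> = \<Phi> ` (C1 \<union> C2)"
  have \<Gamma>: "\<Gamma> = (\<Union>k<Suc m. page (d k) k ` sphere 0 1)"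
    unfolding \<Gamma>_def \<Phi>(3) lessThan_Suc_atMost ..
  have conn: "connected C1" "connected C2"
    using C connected_sphere[of "0::complex" 1] homeomorphic_connectedness by (auto simp: circle_def)
  show ?thesis
  proof (rule that[of \<Gamma> \<Phi>], rule skew_system_from_embedding[where s = "\<lambda>k. page (d k) k" and N = "Suc m"])
    show "is_graph \<Gamma>"
      unfolding \<Gamma>_def by (rule is_graph_injective_image[OF is_graph_Un_circles(1)[OF G C] \<Phi>(1,2)])
    show "connected \<Gamma>"
      unfolding \<Gamma>_def by (intro connected_continuous_image \<Phi>(1) connected_Un conn ne)
    show "norm (direction x) = 1" if x: "x \<in> \<Gamma>" for x
    proof -
      obtain k w where "norm w = 1" "x = page (d k) k w" using x unfolding \<Gamma> by auto
      then show ?thesis using direction_page d(2) by metis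
    qed
    show "continuous_on (sphere 0 1) (page (d k) k)" for k using d(1) by (intro continuous_on_page) blast
    show "page (d k) k w \<in> \<Gamma>" if "k < Suc m" "norm w = 1" for k w
      using that unfolding \<Gamma> by (intro UN_I[of k]) auto
    show "direction (page (d k) k w) = w" if "norm w = 1" for k w
      using that d(2) by (intro direction_page) auto
    show "\<Phi> ` (C1 \<union> C2) = (\<Union>k<Suc m. page (d k) k ` sphere 0 1)" using \<Gamma> unfolding \<Gamma>_def .
  qed (use C \<Phi>(1,2) in auto)
qed

theorem theoremD:
  shows "(\<forall>(G::'a::metric_space set) C1 C2.
            is_graph G \<and> C1 \<subseteq> G \<and> C2 \<subseteq> G \<and> circle C1 \<and> circle C2 \<and> C1 \<noteq> C2 \<longrightarrow>
            (\<exists>B f \<Gamma> F M b D1 D2. skew_system B f \<Gamma> F M b \<and>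
               circle D1 \<and> circle D2 \<and> D1 \<noteq> D2 \<and>
               M \<inter> ({b} \<times> \<Gamma>) = D1 \<union> D2 \<and>
               (M \<inter> ({b} \<times> \<Gamma>)) homeomorphic (C1 \<union> C2)))
       \<and> (\<exists>B f \<Gamma> F M b D1 D2. skew_system B f \<Gamma> F M b \<and>
               circle D1 \<and> circle D2 \<and> D1 \<inter> D2 = {} \<and>
               M \<inter> ({b} \<times> \<Gamma>) = D1 \<union> D2)"
proof (intro conjI allI impI)
  fix G C1 C2 :: "'a set"
  assume asm: "is_graph G \<and> C1 \<subseteq> G \<and> C2 \<subseteq> G \<and> circle C1 \<and> circle C2 \<and> C1 \<noteq> C2"
  obtain \<Gamma> and \<Phi> :: "'a \<Rightarrow> real^3" where "\<exists>B f F M b. skew_system B f \<Gamma> F M b \<and>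
      circle ((\<lambda>x. (b, \<Phi> x)) ` C1) \<and> circle ((\<lambda>x. (b, \<Phi> x)) ` C2) \<and>
      M \<inter> ({b} \<times> \<Gamma>) = (\<lambda>x. (b, \<Phi> x)) ` C1 \<union> (\<lambda>x. (b, \<Phi> x)) ` C2 \<and>
      (M \<inter> ({b} \<times> \<Gamma>)) homeomorphic (C1 \<union> C2) \<and>
      inj_on (\<lambda>x. (b, \<Phi> x)) (C1 \<union> C2)"
  proof (cases "C1 \<inter> C2 = {}")
    case True
    show thesis by (rule skew_system_disjoint_circles[OF _ _ True]) (use asm in \<open>blast intro: that\<close>)+
  next
    case False
    show thesis
      by (rule skew_system_intersecting_circles[OF _ _ _ _ _ False]) (use asm in \<open>blast intro: that\<close>)+
  qed
  then obtain B f F M b where sys: "skew_system B f \<Gamma> F M b"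
    and D: "circle ((\<lambda>x. (b, \<Phi> x)) ` C1)" "circle ((\<lambda>x. (b, \<Phi> x)) ` C2)"
      "M \<inter> ({b} \<times> \<Gamma>) = (\<lambda>x. (b, \<Phi> x)) ` C1 \<union> (\<lambda>x. (b, \<Phi> x)) ` C2"
      "(M \<inter> ({b} \<times> \<Gamma>)) homeomorphic (C1 \<union> C2)"
    and inj: "inj_on (\<lambda>x. (b, \<Phi> x)) (C1 \<union> C2)"
    by (elim exE conjE)
  \<comment> \<open>An injective map keeps different sets different.\<close>
  have "(\<lambda>x. (b, \<Phi> x)) ` C1 \<noteq> (\<lambda>x. (b, \<Phi> x)) ` C2"
    using asm inj_on_image_eq_iff[OF inj, of C1 C2] by blast
  then show "\<exists>B f \<Gamma> F M b D1 D2. skew_system B f \<Gamma> F M b \<and>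
      circle D1 \<and> circle D2 \<and> D1 \<noteq> D2 \<and> M \<inter> ({b} \<times> \<Gamma>) = D1 \<union> D2 \<and>
      (M \<inter> ({b} \<times> \<Gamma>)) homeomorphic (C1 \<union> C2)"
    using sys D by blast
next
  \<comment> \<open>The type \<open>'a\<close> may contain no two disjoint circles, so the second
    claim starts from two parallel circles in space.\<close>
  let ?C = "\<lambda>c. (\<lambda>w. point3 w c) ` sphere 0 1"
  have circ: "circle (?C c)" for c
  proof -
    have "sphere (0::complex) 1 homeomorphic ?C c"
      by (rule homeomorphic_compact[OF compact_sphere _ refl])
         (auto simp: inj_on_def point3_eq_iff intro!: continuous_intros)
    then show ?thesis unfolding circle_def by (subst homeomorphic_sym)
  qed
  have disj: "?C 0 \<inter> ?C 1 = {}" by (auto simp: point3_eq_iff)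
  obtain \<Phi> :: "real^3 \<Rightarrow> real^3" where "\<exists>B f F M b. skew_system B f dumbbell F M b \<and>
      circle ((\<lambda>x. (b, \<Phi> x)) ` ?C 0) \<and> circle ((\<lambda>x. (b, \<Phi> x)) ` ?C 1) \<and>
      M \<inter> ({b} \<times> dumbbell) = (\<lambda>x. (b, \<Phi> x)) ` ?C 0 \<union> (\<lambda>x. (b, \<Phi> x)) ` ?C 1 \<and>
      (M \<inter> ({b} \<times> dumbbell)) homeomorphic (?C 0 \<union> ?C 1) \<and>
      inj_on (\<lambda>x. (b, \<Phi> x)) (?C 0 \<union> ?C 1)"
    by (rule skew_system_disjoint_circles[OF circ circ disj])
  then obtain B f F M b where sys: "skew_system B f dumbbell F M b"
    and D: "circle ((\<lambda>x. (b, \<Phi> x)) ` ?C 0)" "circle ((\<lambda>x. (b, \<Phi> x)) ` ?C 1)"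
      "M \<inter> ({b} \<times> dumbbell) = (\<lambda>x. (b, \<Phi> x)) ` ?C 0 \<union> (\<lambda>x. (b, \<Phi> x)) ` ?C 1"
    and inj: "inj_on (\<lambda>x. (b, \<Phi> x)) (?C 0 \<union> ?C 1)"
    by (elim exE conjE)
  have "(\<lambda>x. (b, \<Phi> x)) ` ?C 0 \<inter> (\<lambda>x. (b, \<Phi> x)) ` ?C 1 = {}"
    using inj_on_image_Int[OF inj, of "?C 0" "?C 1"] disj by simp
  then show "\<exists>B f \<Gamma> F M b D1 D2. skew_system B f \<Gamma> F M b \<and>
      circle D1 \<and> circle D2 \<and> D1 \<inter> D2 = {} \<and> M \<inter> ({b} \<times> \<Gamma>) = D1 \<union> D2"
    using sys D by blast
qed

end
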